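(* Let $n,p$ be integers with $2\le p\le n-2$, let $\beta>0$, and let $\mathrm{St}_\beta(n,p)$ be the Stiefel manifold $\mathrm{St}(n,p)$ endowed with the Riemannian metric $g$ with parameter $\beta$ described in the context. Let $$t^{\mathrm r}_\beta:=\min\left\{t>0\;\middle|\;\frac{\sin t}{t}+\frac{1-\beta}{\beta}\cos t=0\right\}.$$ Then the injectivity radius of $\mathrm{St}_\beta(n,p)$ satisfies $$\mathrm{inj}_{\mathrm{St}_\beta(n,p)}\le\min\left\{\sqrt{2\beta}\,\pi,\ \pi,\ t^{\mathrm r}_\beta\sqrt2\right\}.$$
   Context: Notation: $\mathrm{St}(n,p):=\{X\in\mathbb R^{n\times p}\mid X^\top X=I_p\}$ is the Stiefel manifold, a submanifold of $\mathbb R^{n\times p}$; $\mathrm O(n)$ is the orthogonal group; $\mathcal S_{\mathrm{skew}}(p)$ is the set of real skew-symmetric $p\times p$ matrices; $I_{n\times p}:=\begin{bmatrix}I_p\\0_{(n-p)\times p}\end{bmatrix}$. Every $X\in\mathrm{St}(n,p)$ can be written $X=QI_{n\times p}$ with $Q\in\mathrm O(n)$, and then $\mathrm T_X\mathrm{St}(n,p)=\left\{Q\begin{bmatrix}A\\H\end{bmatrix}\mid A\in\mathcal S_{\mathrm{skew}}(p),\ H\in\mathbb R^{(n-p)\times p}\right\}$. Metric: for $\beta>0$, and tangent vectors $\xi_{\mathrm a}=Q\begin{bmatrix}A_{\mathrm a}\\H_{\mathrm a}\end{bmatrix}$, $\xi_{\mathrm b}=Q\begin{bmatrix}A_{\mathrm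 b}\\H_{\mathrm b}\end{bmatrix}$ at $QI_{n\times p}$, $$g_{QI_{n\times p}}(\xi_{\mathrm a},\xi_{\mathrm b})=\beta\,\mathrm{trace}(A_{\mathrm a}^\top A_{\mathrm b})+\mathrm{trace}(H_{\mathrm a}^\top H_{\mathrm b}),$$ which does not depend on the choice of $Q$. Injectivity radius: let $\mathcal M$ be a complete Riemannian manifold with induced distance $d$. For a unit tangent vector $\xi$ at $x$, let $\gamma_\xi$ be the geodesic with $\gamma_\xi(0)=x$, $\gamma_\xi'(0)=\xi$, and let the cut time be $t_{\mathrm c}(\xi):=\sup\{t>0\mid d(x,\gamma_\xi(t))=t\}$. The injectivity radius of $x$ is $\mathrm{inj}_{\mathcal M}(x):=\inf\{t_{\mathrm c}(\xi)\mid \xi\in\mathrm T_x\mathcal M,\ \|\xi\|=1\}$ (equivalently, the largest $r$ such that the Riemannian exponential at $x$ is a diffeomorphism of the open ball of radius $r$ in $\mathrm T_x\mathcal M$ onto its image), and the injectivity radius of $\mathcal M$ is $\mathrm{inj}_{\mathcal M}:=\inf_{x\in\mathcal M}\mathrm{inj}_{\mathcal M}(x)$. *)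

theory Defs
  imports "HOL-Analysis.Analysis"
begin

section \<open>Riemannian submanifolds of a Euclidean space\<close>

text \<open>
  A Riemannian submanifold of a Euclidean space is represented by its carrier \<open>M\<close>, its tangent
  spaces \<open>T x\<close> (as linear subspaces of the ambient space) and its metric \<open>g x u v\<close>, which is
  meaningful only for \<open>x \<in> M\<close> and \<open>u, v \<in> T x\<close>.
\<close>

text \<open>
  The induced distance: infimum of the lengths of piecewise \<open>C\<^sup>1\<close> curves in \<open>M\<close>.
  The library notion \<open>piecewise_C1_differentiable_on\<close> lets the derivative be unbounded near the
  break points. Length is therefore stated with \<open>has_integral\<close>, which leaves out curves
  with non-integrable speed; \<open>integral\<close> would assign them length 0.
  The real infimum is meaningful when \<open>M\<close> is connected.
\<close>

definition curve_length_is ::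
    "('a::euclidean_space \<Rightarrow> 'a \<Rightarrow> 'a \<Rightarrow> real) \<Rightarrow> (real \<Rightarrow> 'a) \<Rightarrow> real \<Rightarrow> bool" where
  "curve_length_is g c L \<longleftrightarrow>
     ((\<lambda>t. sqrt (g (c t) (vector_derivative c (at t)) (vector_derivative c (at t))))
        has_integral L) {0..1}"

definition riemannian_dist ::
    "'a::euclidean_space set \<Rightarrow> ('a \<Rightarrow> 'a \<Rightarrow> 'a \<Rightarrow> real) \<Rightarrow> 'a \<Rightarrow> 'a \<Rightarrow> real" where
  "riemannian_dist M g x y =
     Inf {L. \<exists>c. c piecewise_C1_differentiable_on {0..1} \<and> c ` {0..1} \<subseteq> M \<and>
                 c 0 = x \<and> c 1 = y \<and> curve_length_is g c L}"

text \<open>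
  Geodesics are the curves with zero covariant acceleration for the Levi-Civita connection.
  If \<open>g\<close> is the restriction to \<open>M\<close> of a metric \<open>G\<close> of the ambient space, the Levi-Civita
  connection of \<open>M\<close> is the \<open>G\<close>-orthogonal projection to the tangent spaces of that of \<open>G\<close>. In
  the Cartesian coordinates of the ambient space, the latter is given by the Christoffel symbols
  of the first kind
  \<open>\<Gamma>(u, v; w) = (D\<^sub>u G(v, w) + D\<^sub>v G(u, w) - D\<^sub>w G(u, v)) / 2\<close>,
  and zero tangential acceleration of \<open>c\<close> reads \<open>G(c'', w) + \<Gamma>(c', c'; w) = 0\<close> for all
  tangent \<open>w\<close>. This condition on \<open>c\<close> does not depend on the choice of the extension \<open>G\<close>.
\<close>

definition metric_extension ::
    "'a::euclidean_space set \<Rightarrow> ('a \<Rightarrow> 'a set) \<Rightarrow> ('a \<Rightarrow> 'a \<Rightarrow> 'a \<Rightarrow> real) \<Rightarrow>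
     ('a \<Rightarrow> 'a \<Rightarrow> 'a \<Rightarrow> real) \<Rightarrow> bool" where
  "metric_extension M T g G \<longleftrightarrow>
     (\<forall>x. bilinear (G x)) \<and>
     (\<forall>x u v. G x u v = G x v u) \<and>
     (\<forall>x u v. (\<lambda>y. G y u v) differentiable (at x)) \<and>
     (\<forall>x\<in>M. \<forall>u. u \<noteq> 0 \<longrightarrow> G x u u > 0) \<and>
     (\<forall>x\<in>M. \<forall>u\<in>T x. \<forall>v\<in>T x. G x u v = g x u v)"

definition christoffel1 ::
    "('a::euclidean_space \<Rightarrow> 'a \<Rightarrow> 'a \<Rightarrow> real) \<Rightarrow> 'a \<Rightarrow> 'a \<Rightarrow> 'a \<Rightarrow> 'a \<Rightarrow> real" where
  "christoffel1 G x u v w =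
     (frechet_derivative (\<lambda>y. G y v w) (at x) u
      + frechet_derivative (\<lambda>y. G y u w) (at x) v
      - frechet_derivative (\<lambda>y. G y u v) (at x) w) / 2"

text \<open>
  Geodesics are taken to be defined on the whole real line, which is appropriate for complete
  manifolds.
\<close>

definition is_geodesic ::
    "'a::euclidean_space set \<Rightarrow> ('a \<Rightarrow> 'a set) \<Rightarrow> ('a \<Rightarrow> 'a \<Rightarrow> 'a \<Rightarrow> real) \<Rightarrow>
     (real \<Rightarrow> 'a) \<Rightarrow> bool" where
  "is_geodesic M T g c \<longleftrightarrow>
     (\<forall>t. c t \<in> M) \<and>
     (\<exists>G. metric_extension M T g G \<and>
       (\<exists>c' c''. \<forall>t. (c has_vector_derivative c' t) (at t) \<and>
                     (c' has_vector_derivative c'' t) (at t) \<and>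
                     (\<forall>w\<in>T (c t). G (c t) (c'' t) w + christoffel1 G (c t) (c' t) (c' t) w = 0)))"

text \<open>
  The cut time may be infinite in general, hence the use of \<open>ereal\<close>. The function
  \<open>cut_time\<close> is applied below to the geodesic \<open>c\<close> with initial point \<open>x\<close> and initial
  velocity \<open>\<xi>\<close>.
\<close>

definition cut_time ::
    "'a::euclidean_space set \<Rightarrow> ('a \<Rightarrow> 'a \<Rightarrow> 'a \<Rightarrow> real) \<Rightarrow> (real \<Rightarrow> 'a) \<Rightarrow> ereal" where
  "cut_time M g c = Sup {ereal t |t. t > 0 \<and> riemannian_dist M g (c 0) (c t) = t}"

definition injectivity_radius_at ::
    "'a::euclidean_space set \<Rightarrow> ('a \<Rightarrow> 'a set) \<Rightarrow> ('a \<Rightarrow> 'a \<Rightarrow> 'a \<Rightarrow> real) \<Rightarrow> 'a \<Rightarrow> ereal" where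
  "injectivity_radius_at M T g x =
     Inf {cut_time M g c |c \<xi>. \<xi> \<in> T x \<and> sqrt (g x \<xi> \<xi>) = 1 \<and> is_geodesic M T g c \<and>
                               c 0 = x \<and> (c has_vector_derivative \<xi>) (at 0)}"

definition injectivity_radius ::
    "'a::euclidean_space set \<Rightarrow> ('a \<Rightarrow> 'a set) \<Rightarrow> ('a \<Rightarrow> 'a \<Rightarrow> 'a \<Rightarrow> real) \<Rightarrow> ereal" where
  "injectivity_radius M T g = (INF x\<in>M. injectivity_radius_at M T g x)"


section \<open>The Stiefel manifold\<close>

text \<open>
  The \<open>n\<close> rows are indexed by the sum type \<open>'p + 'q\<close>, with \<open>CARD('p) = p\<close> and
  \<open>CARD('q) = n - p\<close>, so that block matrices with blocks of \<open>p\<close> and \<open>n - p\<close> rows are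
  available.
\<close>

definition vstack :: "real^'p^'p \<Rightarrow> real^'p^'q \<Rightarrow> real^'p^('p::finite + 'q::finite)" where
  "vstack A H = (\<chi> i. case i of Inl k \<Rightarrow> A $ k | Inr l \<Rightarrow> H $ l)"

abbreviation I_np :: "real^'p^('p::finite + 'q::finite)" where
  "I_np \<equiv> vstack (mat 1) 0"

definition stiefel :: "(real^'p^('p::finite + 'q::finite)) set" where
  "stiefel = {X. transpose X ** X = mat 1}"

definition skew_symmetric :: "real^'p^'p \<Rightarrow> bool" where
  "skew_symmetric A \<longleftrightarrow> transpose A = - A"

definition stiefel_tangent ::
    "real^'p^('p::finite + 'q::finite) \<Rightarrow> (real^'p^('p + 'q)) set" where
  "stiefel_tangent X =
     {Q ** vstack A H |Q A H. orthogonal_matrix Q \<and> X = Q ** I_np \<and> skew_symmetric A}"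

definition stiefel_metric ::
    "real \<Rightarrow> real^'p^('p::finite + 'q::finite) \<Rightarrow> real^'p^('p + 'q) \<Rightarrow> real^'p^('p + 'q) \<Rightarrow> real"
  where
  "stiefel_metric \<beta> X \<xi>\<^sub>a \<xi>\<^sub>b =
     (THE r. \<exists>Q A\<^sub>a H\<^sub>a A\<^sub>b H\<^sub>b.
        orthogonal_matrix Q \<and> X = Q ** I_np \<and> skew_symmetric A\<^sub>a \<and> skew_symmetric A\<^sub>b \<and>
        \<xi>\<^sub>a = Q ** vstack A\<^sub>a H\<^sub>a \<and> \<xi>\<^sub>b = Q ** vstack A\<^sub>b H\<^sub>b \<and>
        r = \<beta> * trace (transpose A\<^sub>a ** A\<^sub>b) + trace (transpose H\<^sub>a ** H\<^sub>b))"

lemma transpose_vstack_mult: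
  "transpose (vstack A H) ** vstack B K = transpose A ** B + transpose H ** K"
  by (simp add: vec_eq_iff matrix_matrix_mult_def transpose_def vstack_def
      UNIV_Plus_UNIV[symmetric] sum.Plus del: UNIV_Plus_UNIV)

lemma orthogonal_cancel:
  fixes Q :: "real^'n^'n" and Y Z :: "real^'p^'n"
  assumes "orthogonal_matrix Q"
  shows "transpose (Q ** Y) ** (Q ** Z) = transpose Y ** Z"
proof -
  have "transpose (Q ** Y) ** (Q ** Z) = transpose Y ** ((transpose Q ** Q) ** Z)"
    by (simp only: matrix_transpose_mul matrix_mul_assoc)
  then show ?thesis
    using assms by (simp add: orthogonal_matrix)
qed

lemma transpose_I_np_vstack:
  fixes A :: "real^'p^'p" and H :: "real^'p^'q"
  shows "transpose I_np ** vstack A H = A"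
proof -
  have "transpose (0::real^'p^'q) ** H = 0"
    by (simp add: vec_eq_iff matrix_matrix_mult_def transpose_def)
  then show ?thesis
    by (simp add: transpose_vstack_mult)
qed

text \<open>
  With \<open>X = Q I\<^sub>n\<^sub>p\<close> and \<open>\<xi> = Q [A; H]\<close> one has \<open>A = X\<^sup>T \<xi>\<close>, so that the metric is the
  restriction of the following form, defined on all pairs of \<open>n \<times> p\<close> matrices. It serves to show
  that the metric is well defined and that it has an extension in the sense of
  \<open>metric_extension\<close>.
\<close>

definition stiefel_metric_ext ::
    "real \<Rightarrow> real^'p^('p::finite + 'q::finite) \<Rightarrow> real^'p^('p + 'q) \<Rightarrow> real^'p^('p + 'q) \<Rightarrow> real"
  where
  "stiefel_metric_ext \<beta> X U V =
     trace (transpose U ** V)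
     + (\<beta> - 1) * trace (transpose (transpose X ** U) ** (transpose X ** V))"

lemma stiefel_metric_ext_eq:
  assumes "orthogonal_matrix Q"
  shows "stiefel_metric_ext \<beta> (Q ** I_np) (Q ** vstack A H) (Q ** vstack B K) =
    \<beta> * trace (transpose A ** B) + trace (transpose H ** K)"
  unfolding stiefel_metric_ext_def orthogonal_cancel[OF assms] transpose_I_np_vstack
  by (simp add: transpose_vstack_mult trace_add algebra_simps)

text \<open>The metric does not depend on the choice of \<open>Q\<close>:\<close>

lemma stiefel_metric_eq:
  assumes "orthogonal_matrix Q" "skew_symmetric A\<^sub>a" "skew_symmetric A\<^sub>b"
  shows "stiefel_metric \<beta> (Q ** I_np) (Q ** vstack A\<^sub>a H\<^sub>a) (Q ** vstack A\<^sub>b H\<^sub>b) =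
    \<beta> * trace (transpose A\<^sub>a ** A\<^sub>b) + trace (transpose H\<^sub>a ** H\<^sub>b)"
  unfolding stiefel_metric_def
proof (rule the_equality)
  show "\<exists>Q' A\<^sub>a' H\<^sub>a' A\<^sub>b' H\<^sub>b'. orthogonal_matrix Q' \<and> Q ** I_np = Q' ** I_np \<and>
      skew_symmetric A\<^sub>a' \<and> skew_symmetric A\<^sub>b' \<and>
      Q ** vstack A\<^sub>a H\<^sub>a = Q' ** vstack A\<^sub>a' H\<^sub>a' \<and> Q ** vstack A\<^sub>b H\<^sub>b = Q' ** vstack A\<^sub>b' H\<^sub>b' \<and>
      \<beta> * trace (transpose A\<^sub>a ** A\<^sub>b) + trace (transpose H\<^sub>a ** H\<^sub>b) =
      \<beta> * trace (transpose A\<^sub>a' ** A\<^sub>b') + trace (transpose H\<^sub>a' ** H\<^sub>b')"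
    using assms by blast
next
  fix r
  assume "\<exists>Q' A\<^sub>a' H\<^sub>a' A\<^sub>b' H\<^sub>b'. orthogonal_matrix Q' \<and> Q ** I_np = Q' ** I_np \<and>
      skew_symmetric A\<^sub>a' \<and> skew_symmetric A\<^sub>b' \<and>
      Q ** vstack A\<^sub>a H\<^sub>a = Q' ** vstack A\<^sub>a' H\<^sub>a' \<and> Q ** vstack A\<^sub>b H\<^sub>b = Q' ** vstack A\<^sub>b' H\<^sub>b' \<and>
      r = \<beta> * trace (transpose A\<^sub>a' ** A\<^sub>b') + trace (transpose H\<^sub>a' ** H\<^sub>b')"
  then show "r = \<beta> * trace (transpose A\<^sub>a ** A\<^sub>b) + trace (transpose H\<^sub>a ** H\<^sub>b)"
    using stiefel_metric_ext_eq assms(1) by metis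
qed

lemma trace_transpose_mult_inner:
  fixes A B :: "real^'p^'n"
  shows "trace (transpose A ** B) = A \<bullet> B"
proof -
  have "trace (transpose A ** B) = (\<Sum>j\<in>UNIV. \<Sum>i\<in>UNIV. A $ i $ j * B $ i $ j)"
    by (simp add: trace_def matrix_matrix_mult_def transpose_def)
  also have "\<dots> = (\<Sum>i\<in>UNIV. \<Sum>j\<in>UNIV. A $ i $ j * B $ i $ j)"
    by (rule sum.swap)
  finally show ?thesis
    by (simp add: inner_vec_def)
qed

lemma stiefel_metric_ext_inner:
  "stiefel_metric_ext \<beta> X U V = U \<bullet> V + (\<beta> - 1) * ((transpose X ** U) \<bullet> (transpose X ** V))"
  by (simp add: stiefel_metric_ext_def trace_transpose_mult_inner)

lemma stiefel_metric_extension: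
  assumes "\<beta> > 0"
  shows "metric_extension (stiefel :: (real^'p^('p::finite + 'q::finite)) set) stiefel_tangent
    (stiefel_metric \<beta>) (stiefel_metric_ext \<beta>)"
proof -
  let ?G = "stiefel_metric_ext \<beta> :: real^'p^('p + 'q) \<Rightarrow> _"
  have lin: "linear ((**) Y)" for Y :: "real^('p + 'q)^'p"
    by (rule linearI)
       (simp_all add: vec_eq_iff matrix_matrix_mult_def sum.distrib[symmetric] sum_distrib_left
          algebra_simps)
  have bil: "bilinear (?G X)" for X
    unfolding bilinear_def stiefel_metric_ext_inner
    by (intro conjI allI linearI)
       (simp_all add: linear_add[OF lin] linear_scale[OF lin] inner_simps algebra_simps)
  have sym: "?G X U V = ?G X V U" for X U V
    by (simp add: stiefel_metric_ext_inner inner_commute)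
  have blin: "bounded_linear (\<lambda>X :: real^'p^('p + 'q). transpose X ** U)" for U :: "real^'p^('p + 'q)"
    unfolding linear_conv_bounded_linear[symmetric]
    by (rule linearI)
       (simp_all add: vec_eq_iff matrix_matrix_mult_def transpose_def sum.distrib[symmetric]
          sum_distrib_left algebra_simps)
  have diff: "(\<lambda>Y. ?G Y U V) differentiable (at X)" for X U V
  proof -
    have "((\<lambda>Y. U \<bullet> V + (\<beta> - 1) * ((transpose Y ** U) \<bullet> (transpose Y ** V))) has_derivative
       (\<lambda>Z. (\<beta> - 1) * ((transpose X ** U) \<bullet> (transpose Z ** V) +
                        (transpose Z ** U) \<bullet> (transpose X ** V)))) (at X)"
      by (auto intro!: derivative_eq_intros bounded_linear_imp_has_derivative[OF blin])
    then show ?thesis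
      unfolding differentiable_def stiefel_metric_ext_inner by blast
  qed
  have pos: "?G X U U > 0" if X: "X \<in> stiefel" and U: "U \<noteq> 0" for X U
  proof -
    define W where "W = transpose X ** U"
    have 1: "(X ** W) \<bullet> (X ** W) = W \<bullet> W"
    proof -
      have "transpose (X ** W) ** (X ** W) = transpose W ** ((transpose X ** X) ** W)"
        by (simp only: matrix_transpose_mul matrix_mul_assoc)
      also have "\<dots> = transpose W ** W"
        using X by (simp add: stiefel_def)
      finally show ?thesis
        by (simp flip: trace_transpose_mult_inner)
    qed
    have 2: "(X ** W) \<bullet> U = W \<bullet> W"
      unfolding trace_transpose_mult_inner[symmetric] W_def
      by (simp add: matrix_transpose_mul matrix_mul_assoc)
    have "0 \<le> (U - X ** W) \<bullet> (U - X ** W)"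
      by simp
    also have "\<dots> = U \<bullet> U - W \<bullet> W"
      using 1 2 by (simp add: inner_diff inner_commute)
    finally have le: "W \<bullet> W \<le> U \<bullet> U"
      by simp
    have "?G X U U = (U \<bullet> U - W \<bullet> W) + \<beta> * (W \<bullet> W)"
      by (simp add: stiefel_metric_ext_inner W_def[symmetric] algebra_simps)
    moreover have "U \<bullet> U > 0" "W \<bullet> W \<ge> 0"
      using U by simp_all
    ultimately show ?thesis
      using le assms by (cases "W \<bullet> W = 0") (simp_all add: add_nonneg_pos)
  qed
  have agree: "?G X u v = stiefel_metric \<beta> X u v"
    if "u \<in> stiefel_tangent X" "v \<in> stiefel_tangent X" for X u v
  proof -
    obtain Q A H where Q: "orthogonal_matrix Q" "X = Q ** I_np" and A: "skew_symmetric A"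
        and u: "u = Q ** vstack A H"
      using \<open>u \<in> stiefel_tangent X\<close> unfolding stiefel_tangent_def by auto
    obtain Q' A' H' where Q': "orthogonal_matrix Q'" "X = Q' ** I_np" and A': "skew_symmetric A'"
        and v: "v = Q' ** vstack A' H'"
      using \<open>v \<in> stiefel_tangent X\<close> unfolding stiefel_tangent_def by auto
    define Y where "Y = transpose Q ** v"
    have vY: "v = Q ** Y"
      using Q(1) by (simp add: Y_def matrix_mul_assoc orthogonal_matrix_def)
    define B :: "real^'p^'p" where "B = (\<chi> i. Y $ Inl i)"
    define K :: "real^'p^'q" where "K = (\<chi> i. Y $ Inr i)"
    have Y: "Y = vstack B K"
      by (simp add: vec_eq_iff vstack_def B_def K_def split: sum.split)
    have "B = transpose X ** v"
      by (simp add: vY Y Q(2) orthogonal_cancel[OF Q(1)] transpose_I_np_vstack)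
    also have "\<dots> = A'"
      by (simp add: v Q'(2) orthogonal_cancel[OF Q'(1)] transpose_I_np_vstack)
    finally have "skew_symmetric B"
      using A' by simp
    then show ?thesis
      unfolding u vY Y Q(2) stiefel_metric_ext_eq[OF Q(1)]
      by (simp add: stiefel_metric_eq[OF Q(1) A])
  qed
  show ?thesis
    unfolding metric_extension_def using bil sym diff pos agree by blast
qed

text \<open>
  \<open>Least\<close> denotes the minimum whenever it exists, and it exists for all \<open>\<beta> > 0\<close>.
\<close>

definition t_r :: "real \<Rightarrow> real" where
  "t_r \<beta> = (LEAST t. t > 0 \<and> sin t / t + (1 - \<beta>) / \<beta> * cos t = 0)"

end

theory Submission
  imports Defs
begin

text \<open>
  Two closed unit-speed geodesics, one rotating two columns into each other and one rotating a single
  column into a fresh direction, have lengths \<open>2 sqrt (2 \<beta>) \<pi>\<close> and \<open>2 \<pi>\<close>. A closed geodesic of length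
  \<open>2 T\<close> does not minimize past \<open>T\<close>, because going round the other way is shorter.

  For the third bound, a copy of the 3-sphere with a Berger metric sits in the Stiefel manifold as the
  frames whose two moving columns are those of a complex vector \<open>(x, y)\<close>. Its geodesic
  \<open>(cos s, sin s)\<close>, \<open>s = t / sqrt 2\<close>, has a conjugate point at \<open>s = t_r \<beta>\<close>. Instead of the second
  variation formula, an explicit family of constant-speed helices with the same end points is used;
  for \<open>t_r \<beta> < s \<le> \<pi>\<close> it contains curves that are strictly shorter than the geodesic. This is
  needed only for \<open>\<beta> < 1\<close>, since otherwise \<open>t_r \<beta> \<ge> \<pi>\<close>.
\<close>

section \<open>Tangent spaces and lengths of curves\<close>

lemma transpose_mult_component:
  fixes X Y :: "real^'p^'n"
  shows "(transpose X ** Y) $ k $ l = column k X \<bullet> column l Y"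
  by (simp add: matrix_matrix_mult_def transpose_def column_def inner_vec_def)

lemma stiefel_iff_column:
  "X \<in> stiefel \<longleftrightarrow> (\<forall>k l. column k X \<bullet> column l X = (if k = l then 1 else 0))"
  by (simp add: stiefel_def vec_eq_iff transpose_mult_component mat_def)

lemma column_mult_I_np:
  fixes Q :: "real^('p::finite + 'q::finite)^('p + 'q)"
  shows "column k (Q ** (I_np :: real^'p^('p + 'q))) = column (Inl k) Q"
proof -
  have "(Q ** (I_np :: real^'p^('p + 'q))) $ r $ k = Q $ r $ Inl k" for r
    by (simp add: matrix_matrix_mult_def vstack_def mat_def sum.Plus if_distrib cong: if_cong
        flip: UNIV_Plus_UNIV)
  then show ?thesis
    by (simp add: column_def)
qed

text \<open>The missing columns are an orthonormal basis of the orthogonal complement of the column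
  span. Its dimension is \<open>CARD('q)\<close>, so it can be indexed by \<open>'q\<close>.\<close>

lemma stiefel_completion:
  fixes X :: "real^'p^('p::finite + 'q::finite)"
  assumes "X \<in> stiefel"
  obtains Q where "orthogonal_matrix Q" "X = Q ** I_np"
proof -
  define f where "f k = column k X" for k
  have f: "f k \<bullet> f l = (if k = l then 1 else 0)" for k l
    using assms by (simp add: stiefel_iff_column f_def)
  have inj: "inj f"
    by (rule injI) (metis f zero_neq_one)
  have po: "pairwise orthogonal (range f)"
    by (auto simp: pairwise_def orthogonal_def f)
  have "0 \<notin> range f"
    by (metis f image_iff inner_zero_left zero_neq_one)
  then have ind: "independent (range f)"
    using po pairwise_orthogonal_independent by blast
  have "dim (range f) = CARD('p)"
    using ind by (simp add: dim_eq_card_independent card_image inj)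
  define S where "S = {y. \<forall>x\<in>span (range f). orthogonal x y}"
  have "dim S + dim (span (range f)) = dim (UNIV :: (real^('p + 'q)) set)"
    using dim_subspace_orthogonal_to_vectors[of "span (range f)" UNIV] by (simp add: S_def)
  then have dS: "dim S = CARD('q)"
    using \<open>dim (range f) = CARD('p)\<close> by simp
  have "subspace S"
    unfolding S_def by (rule subspace_orthogonal_to_vectors)
  then obtain B where B: "B \<subseteq> S" "pairwise orthogonal B" "\<And>x. x \<in> B \<Longrightarrow> norm x = 1"
      "independent B" "card B = dim S"
    using orthonormal_basis_subspace by metis
  have "finite B"
    using B(4) independent_imp_finite by blast
  then obtain h :: "'q \<Rightarrow> _" where h: "bij_betw h UNIV B"
    using B(5) dS by (metis bij_betw_iff_card finite_class.finite_UNIV)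
  have hh: "h k \<bullet> h l = (if k = l then 1 else 0)" for k l
  proof (cases "k = l")
    case True
    have "norm (h k) = 1"
      using h B(3) by (auto simp: bij_betw_def)
    then show ?thesis using True by (simp add: norm_eq_1)
  next
    case False
    then have "h k \<noteq> h l" "h k \<in> B" "h l \<in> B"
      using h by (auto simp: bij_betw_def inj_def)
    then show ?thesis
      using B(2) False by (simp add: pairwise_def orthogonal_def)
  qed
  have fh: "f k \<bullet> h l = 0" for k l
  proof -
    have "h l \<in> S"
      using h B(1) by (auto simp: bij_betw_def)
    then show ?thesis
      by (simp add: S_def orthogonal_def span_base)
  qed
  define Q :: "real^('p + 'q)^('p + 'q)" where "Q = (\<chi> r k. case_sum f h k $ r)"
  have Q: "column k Q = case_sum f h k" for k
    by (simp add: Q_def column_def)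
  have "(transpose Q ** Q) $ k $ l = mat 1 $ k $ l" for k l
    by (cases k; cases l)
      (simp_all add: transpose_mult_component Q f fh hh mat_def inner_commute[of "h _" "f _"])
  then have "orthogonal_matrix Q"
    by (simp add: orthogonal_matrix vec_eq_iff)
  moreover have "column k X = column k (Q ** I_np)" for k
    by (simp add: column_mult_I_np Q f_def)
  then have "X = Q ** I_np"
    by (simp add: column_def vec_eq_iff)
  ultimately show thesis
    using that by blast
qed

section \<open>Tangent vectors without reference to a completion\<close>

lemma skew_transpose_mult_stiefel_tangent:
  assumes "U \<in> stiefel_tangent X"
  shows "skew_symmetric (transpose X ** U)"
proof -
  obtain Q A H where Q: "orthogonal_matrix Q" "X = Q ** I_np" "skew_symmetric A"
      "U = Q ** vstack A H"
    using assms unfolding stiefel_tangent_def by auto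
  then show ?thesis
    by (simp add: orthogonal_cancel transpose_I_np_vstack)
qed

text \<open>Any completion \<open>Q\<close> of \<open>X\<close> works, because the upper block of
  \<open>transpose Q ** U\<close> is \<open>transpose X ** U\<close>. Tangency thus becomes a
  condition on \<open>X\<close> and \<open>U\<close> alone.\<close>

lemma stiefel_tangentI:
  fixes X :: "real^'p^('p::finite + 'q::finite)"
  assumes X: "X \<in> stiefel" and U: "skew_symmetric (transpose X ** U)"
  shows "U \<in> stiefel_tangent X"
proof -
  obtain Q where Q: "orthogonal_matrix Q" "X = Q ** I_np"
    using stiefel_completion[OF X] .
  define Y where "Y = transpose Q ** U"
  define B :: "real^'p^'p" where "B = (\<chi> i. Y $ Inl i)"
  define K :: "real^'p^'q" where "K = (\<chi> i. Y $ Inr i)"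
  have UY: "U = Q ** Y"
    using Q(1) by (simp add: Y_def matrix_mul_assoc orthogonal_matrix_def)
  have Y: "Y = vstack B K"
    by (simp add: vec_eq_iff vstack_def B_def K_def split: sum.split)
  have "transpose X ** U = B"
    by (simp add: UY Y Q(2) orthogonal_cancel[OF Q(1)] transpose_I_np_vstack)
  then show ?thesis
    unfolding stiefel_tangent_def using Q U UY Y by blast
qed

lemma stiefel_metric_tangent:
  assumes "\<beta> > 0" "X \<in> stiefel" "U \<in> stiefel_tangent X"
  shows "stiefel_metric \<beta> X U U = stiefel_metric_ext \<beta> X U U"
  using stiefel_metric_extension[OF assms(1)] assms(2,3) unfolding metric_extension_def by metis

lemma
  assumes "\<beta> > 0"
  shows bilinear_stiefel_metric_ext: "bilinear (stiefel_metric_ext \<beta> X)"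
    and stiefel_metric_ext_pos: "X \<in> stiefel \<Longrightarrow> U \<noteq> 0 \<Longrightarrow> stiefel_metric_ext \<beta> X U U > 0"
  using stiefel_metric_extension[OF assms] unfolding metric_extension_def by metis+

lemma stiefel_metric_nonneg:
  assumes "\<beta> > 0" "X \<in> stiefel" "U \<in> stiefel_tangent X"
  shows "stiefel_metric \<beta> X U U \<ge> 0"
  unfolding stiefel_metric_tangent[OF assms]
  using stiefel_metric_ext_pos[OF assms(1,2)] bilinear_lzero[OF bilinear_stiefel_metric_ext[OF assms(1)]]
  by (metis order.order_iff_strict)

section \<open>Velocities and lengths of curves\<close>

lemma bounded_bilinear_transpose_mult:
  "bounded_bilinear (\<lambda>X Y :: real^'p^'n. transpose X ** Y)"
proof -
  have "bilinear (\<lambda>X Y :: real^'p^'n. transpose X ** Y)"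
    unfolding bilinear_def
    by (intro conjI allI linearI)
      (simp_all add: vec_eq_iff matrix_matrix_mult_def transpose_def algebra_simps
        sum.distrib sum_distrib_left)
  then show ?thesis
    by (simp add: bilinear_conv_bounded_bilinear)
qed

text \<open>Differentiating \<open>transpose (c s) ** c s = mat 1\<close> gives skewness. The open
  set \<open>S\<close> makes this applicable to curves known to stay in \<open>stiefel\<close> only
  over \<open>{0..1}\<close>.\<close>

lemma stiefel_curve_tangent:
  fixes c :: "real \<Rightarrow> real^'p^('p::finite + 'q::finite)"
  assumes "open S" "t \<in> S" "\<And>s. s \<in> S \<Longrightarrow> c s \<in> stiefel" "(c has_vector_derivative U) (at t)"
  shows "U \<in> stiefel_tangent (c t)"
proof -
  have "((\<lambda>s. transpose (c s) ** c s) has_vector_derivative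
      transpose (c t) ** U + transpose U ** c t) (at t)"
    by (rule bounded_bilinear.has_vector_derivative[OF bounded_bilinear_transpose_mult assms(4,4)])
  moreover have "((\<lambda>s. transpose (c s) ** c s) has_vector_derivative 0) (at t)"
    by (rule has_vector_derivative_transform_within_open[OF has_vector_derivative_const assms(1,2)])
      (use assms(3) in \<open>simp add: stiefel_def\<close>)
  ultimately have "transpose (c t) ** U + transpose U ** c t = 0"
    using vector_derivative_unique_at by blast
  moreover have "transpose (transpose (c t) ** U) = transpose U ** c t"
    by (simp add: matrix_transpose_mul)
  ultimately have "skew_symmetric (transpose (c t) ** U)"
    by (simp add: skew_symmetric_def eq_neg_iff_add_eq_0 add.commute)
  then show ?thesis
    using assms(2,3) stiefel_tangentI by blast
qed

text \<open>This bounds the set of lengths below by 0, so that its real infimum is at most each of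
  its elements.\<close>

lemma stiefel_curve_length_nonneg:
  fixes c :: "real \<Rightarrow> real^'p^('p::finite + 'q::finite)"
  assumes "\<beta> > 0" "c piecewise_C1_differentiable_on {0..1}" "c ` {0..1} \<subseteq> stiefel"
    "curve_length_is (stiefel_metric \<beta>) c L"
  shows "L \<ge> 0"
proof -
  obtain F where F: "finite F" "c C1_differentiable_on ({0..1} - F)"
    using assms(2) by (auto simp: piecewise_C1_differentiable_on_def)
  define v where "v t = sqrt (stiefel_metric \<beta> (c t) (vector_derivative c (at t))
    (vector_derivative c (at t)))" for t
  have v: "v t \<ge> 0" if t: "t \<in> {0..1} - (F \<union> {0, 1})" for t
  proof -
    have "(c has_vector_derivative vector_derivative c (at t)) (at t)"
      using F(2) t by (simp add: C1_differentiable_on_eq vector_derivative_works)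
    then have "vector_derivative c (at t) \<in> stiefel_tangent (c t)"
      using t assms(3) by (intro stiefel_curve_tangent[of "{0<..<1}"]) auto
    moreover have "c t \<in> stiefel"
      using t assms(3) by auto
    ultimately show ?thesis
      unfolding v_def using stiefel_metric_nonneg[OF assms(1)] by simp
  qed
  have "(v has_integral L) {0..1}"
    using assms(4) by (simp add: curve_length_is_def v_def[abs_def])
  \<comment> \<open>At break points and end points the velocity may be an arbitrary value, for which
    the metric and its (odd) square root could be negative. Resetting these finitely many values
    leaves the integral unchanged.\<close>
  then have "((\<lambda>t. if t \<in> F \<union> {0, 1} then 0 else v t) has_integral L) {0..1}"
    by (rule has_integral_spike_finite[rotated 2, of _ _ _ "F \<union> {0, 1}"]) (use F(1) in auto)
  then show ?thesis
    by (rule has_integral_nonneg) (use v in auto)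
qed

text \<open>Constant speed \<open>L\<close> makes the length integral trivial; all comparison curves
  below have constant speed.\<close>

lemma riemannian_dist_stiefel_le:
  fixes c c' :: "real \<Rightarrow> real^'p^('p::finite + 'q::finite)"
  assumes "\<beta> > 0" "\<And>t. c t \<in> stiefel" "\<And>t. (c has_vector_derivative c' t) (at t)"
    "continuous_on UNIV c'" "\<And>t. stiefel_metric_ext \<beta> (c t) (c' t) (c' t) = L\<^sup>2" "L \<ge> 0"
  shows "riemannian_dist stiefel (stiefel_metric \<beta>) (c 0) (c 1) \<le> L"
proof -
  have vd: "vector_derivative c (at t) = c' t" for t
    using assms(3) by (rule vector_derivative_at)
  have "c' t \<in> stiefel_tangent (c t)" for t
    by (rule stiefel_curve_tangent[of UNIV]) (use assms in auto)
  then have "sqrt (stiefel_metric \<beta> (c t) (c' t) (c' t)) = L" for t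
    using assms by (simp add: stiefel_metric_tangent)
  then have "curve_length_is (stiefel_metric \<beta>) c L"
    using has_integral_const_real[of L 0 1] by (simp add: curve_length_is_def vd)
  moreover have "c piecewise_C1_differentiable_on {0..1}"
    using assms(3) continuous_on_subset[OF assms(4) subset_UNIV]
    by (intro C1_differentiable_imp_piecewise) (auto simp: C1_differentiable_on_def)
  ultimately show ?thesis
    unfolding riemannian_dist_def
    by (intro cInf_lower bdd_belowI[of _ 0])
      (use assms(2) stiefel_curve_length_nonneg[OF assms(1)] in blast)+
qed

section \<open>Geodesics and cut times\<close>

lemma inner_mult_left:
  fixes X W :: "real^'p^'n" and S :: "real^'p^'p"
  shows "(X ** S) \<bullet> W = S \<bullet> (transpose X ** W)"
  by (simp add: matrix_transpose_mul matrix_mul_assoc flip: trace_transpose_mult_inner)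

lemma inner_transpose:
  fixes A B :: "real^'p^'n"
  shows "transpose A \<bullet> transpose B = A \<bullet> B"
  unfolding inner_vec_def by (simp add: transpose_def) (rule sum.swap)

lemma inner_symmetric_skew:
  fixes S B :: "real^'p^'p"
  assumes "transpose S = S" "skew_symmetric B"
  shows "S \<bullet> B = 0"
  using inner_transpose[of S B] assms by (simp add: skew_symmetric_def)

lemma frechet_derivative_stiefel_metric_ext:
  fixes X U V Z :: "real^'p^('p::finite + 'q::finite)"
  shows
  "frechet_derivative (\<lambda>Y. stiefel_metric_ext \<beta> Y U V) (at X) Z =
    (\<beta> - 1) * ((transpose X ** U) \<bullet> (transpose Z ** V) + (transpose Z ** U) \<bullet> (transpose X ** V))"
proof -
  have d: "((\<lambda>Y. transpose Y ** W) has_derivative (\<lambda>Z. transpose Z ** W)) (at X)"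
    for W :: "real^'p^('p + 'q)"
    by (intro bounded_linear_imp_has_derivative
        bounded_bilinear.bounded_linear_left[OF bounded_bilinear_transpose_mult])
  have "((\<lambda>Y. U \<bullet> V + (\<beta> - 1) * ((transpose Y ** U) \<bullet> (transpose Y ** V))) has_derivative
     (\<lambda>Z. 0 + (\<beta> - 1) * ((transpose X ** U) \<bullet> (transpose Z ** V) +
                      (transpose Z ** U) \<bullet> (transpose X ** V)))) (at X)"
    by (intro has_derivative_add has_derivative_const has_derivative_mult_right has_derivative_inner d)
  from frechet_derivative_at[OF this, symmetric] show ?thesis
    by (simp add: stiefel_metric_ext_inner)
qed

lemma christoffel1_stiefel_metric_ext:
  "christoffel1 (stiefel_metric_ext \<beta>) X U U W =
    (\<beta> - 1) * ((transpose U ** U) \<bullet> (transpose X ** W)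
      + (transpose X ** U) \<bullet> (transpose U ** W) - (transpose X ** U) \<bullet> (transpose W ** U))"
  by (simp add: christoffel1_def frechet_derivative_stiefel_metric_ext inner_commute field_simps)

text \<open>A tangent \<open>W\<close> pairs with \<open>c t ** S\<close> as \<open>S\<close> pairs
  with the skew matrix \<open>transpose (c t) ** W\<close>, which gives 0 for symmetric
  \<open>S\<close>. Under the two symmetry assumptions every term of the geodesic equation vanishes
  separately.\<close>

lemma stiefel_geodesicI:
  fixes c c' c'' :: "real \<Rightarrow> real^'p^('p::finite + 'q::finite)"
  assumes "\<beta> > 0" and M: "\<And>t. c t \<in> stiefel"
    and c': "\<And>t. (c has_vector_derivative c' t) (at t)"
    and c'': "\<And>t. (c' has_vector_derivative c'' t) (at t)"
    and S: "\<And>t. c'' t = c t ** S t" "\<And>t. transpose (S t) = S t"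
    and R: "\<And>t. c' t ** (transpose (c t) ** c' t) = c t ** R t" "\<And>t. transpose (R t) = R t"
  shows "is_geodesic stiefel stiefel_tangent (stiefel_metric \<beta>) c"
proof -
  have "stiefel_metric_ext \<beta> (c t) (c'' t) W +
      christoffel1 (stiefel_metric_ext \<beta>) (c t) (c' t) (c' t) W = 0"
    if W: "W \<in> stiefel_tangent (c t)" for t W
  proof -
    let ?X = "c t" and ?U = "c' t"
    have B: "skew_symmetric (transpose ?X ** W)"
      using W by (rule skew_transpose_mult_stiefel_tangent)
    have A: "skew_symmetric (transpose ?X ** ?U)"
      by (rule skew_transpose_mult_stiefel_tangent, rule stiefel_curve_tangent[of UNIV])
        (use M c' in auto)
    have "transpose ?X ** c'' t = S t"
      using M[of t] by (simp add: S(1) matrix_mul_assoc stiefel_def)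
    then have 1: "stiefel_metric_ext \<beta> ?X (c'' t) W = 0"
      using inner_mult_left[of ?X "S t" W] inner_symmetric_skew[OF S(2) B, of t]
      by (simp add: stiefel_metric_ext_inner) (simp add: S(1))
    have 2: "(transpose ?U ** ?U) \<bullet> (transpose ?X ** W) = 0"
      by (rule inner_symmetric_skew[OF _ B]) (simp add: matrix_transpose_mul)
    \<comment> \<open>Moving \<open>?U\<close> to the left factor produces
      \<open>?U ** (transpose ?X ** ?U)\<close>, which is \<open>?X ** R t\<close> by
      assumption.\<close>
    have 3: "(transpose ?X ** ?U) \<bullet> (transpose ?U ** W) = 0"
      using inner_mult_left[of ?U "transpose ?X ** ?U" W] inner_mult_left[of ?X "R t" W]
        inner_symmetric_skew[OF R(2) B, of t]
      by (simp add: R(1))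
    have "(transpose ?X ** ?U) \<bullet> (transpose W ** ?U) =
        transpose (transpose ?X ** ?U) \<bullet> (transpose ?U ** W)"
      by (subst inner_transpose[symmetric]) (simp add: matrix_transpose_mul)
    also have "\<dots> = 0"
      using A 3 by (simp add: skew_symmetric_def)
    finally show ?thesis
      by (simp add: christoffel1_stiefel_metric_ext 1 2 3)
  qed
  then show ?thesis
    unfolding is_geodesic_def using M c' c'' stiefel_metric_extension[OF assms(1)] by blast
qed

section \<open>Upper bounds for cut times\<close>

lemma injectivity_radius_le_cut_time:
  fixes c :: "real \<Rightarrow> real^'p^('p::finite + 'q::finite)"
  assumes "\<beta> > 0" and geo: "is_geodesic stiefel stiefel_tangent (stiefel_metric \<beta>) c"
    and \<xi>: "(c has_vector_derivative \<xi>) (at 0)" "stiefel_metric_ext \<beta> (c 0) \<xi> \<xi> = 1"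
  shows "injectivity_radius (stiefel :: (real^'p^('p + 'q)) set) stiefel_tangent (stiefel_metric \<beta>)
    \<le> cut_time stiefel (stiefel_metric \<beta>) c"
proof -
  have M: "c t \<in> stiefel" for t
    using geo by (simp add: is_geodesic_def)
  then have T: "\<xi> \<in> stiefel_tangent (c 0)"
    using \<xi>(1) by (intro stiefel_curve_tangent[of UNIV]) auto
  then have "stiefel_metric \<beta> (c 0) \<xi> \<xi> = 1"
    using stiefel_metric_tangent[OF assms(1) M T] \<xi>(2) by simp
  then have "injectivity_radius_at stiefel stiefel_tangent (stiefel_metric \<beta>) (c 0)
      \<le> cut_time stiefel (stiefel_metric \<beta>) c"
    unfolding injectivity_radius_at_def using T geo \<xi>(1) by (intro Inf_lower) auto
  then show ?thesis
    unfolding injectivity_radius_def by (rule order_trans[OF INF_lower[OF M[of 0]]])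
qed

text \<open>The curve is reparametrised as \<open>c (s * t)\<close> over \<open>{0..1}\<close>.
  Negative \<open>t\<close> is included in order to run along a closed geodesic backwards.\<close>

lemma riemannian_dist_constant_speed_le:
  fixes c c' :: "real \<Rightarrow> real^'p^('p::finite + 'q::finite)"
  assumes "\<beta> > 0" "\<And>t. c t \<in> stiefel" "\<And>t. (c has_vector_derivative c' t) (at t)"
    "continuous_on UNIV c'" "\<And>t. stiefel_metric_ext \<beta> (c t) (c' t) (c' t) = 1"
  shows "riemannian_dist stiefel (stiefel_metric \<beta>) (c 0) (c t) \<le> \<bar>t\<bar>"
proof -
  note bil = bilinear_stiefel_metric_ext[OF assms(1)]
  have "((\<lambda>s. c (s * t)) has_vector_derivative t *\<^sub>R c' (s * t)) (at s)" for s
    proof -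
      have "((\<lambda>s. s * t) has_vector_derivative t) (at s)"
        by (auto intro!: derivative_eq_intros simp flip: has_real_derivative_iff_has_vector_derivative)
      from vector_diff_chain_at[OF this assms(3)] show ?thesis
        by (simp add: o_def)
    qed
  moreover have "continuous_on UNIV (\<lambda>s. t *\<^sub>R c' (s * t))"
    by (intro continuous_intros continuous_on_compose2[OF assms(4)]) auto
  moreover have "stiefel_metric_ext \<beta> (c (s * t)) (t *\<^sub>R c' (s * t)) (t *\<^sub>R c' (s * t)) = \<bar>t\<bar>\<^sup>2" for s
    by (simp add: bilinear_lmul[OF bil] bilinear_rmul[OF bil] assms(5) power2_eq_square)
  ultimately show ?thesis
    using riemannian_dist_stiefel_le[of \<beta> "\<lambda>s. c (s * t)" "\<lambda>s. t *\<^sub>R c' (s * t)" "\<bar>t\<bar>"] assms(1,2)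
    by simp
qed

text \<open>The point \<open>c t\<close> is also reached at parameter \<open>t - 2 * T\<close>, and
  \<bar>t - 2 * T\<bar> < t as soon as \<open>0 < T < t\<close>.\<close>

lemma riemannian_dist_periodic_less:
  fixes c c' :: "real \<Rightarrow> real^'p^('p::finite + 'q::finite)"
  assumes "\<beta> > 0" "\<And>t. c t \<in> stiefel" "\<And>t. (c has_vector_derivative c' t) (at t)"
    "continuous_on UNIV c'" "\<And>t. stiefel_metric_ext \<beta> (c t) (c' t) (c' t) = 1"
    and "\<And>t. c (t - 2 * T) = c t" "T > 0" "T < t"
  shows "riemannian_dist stiefel (stiefel_metric \<beta>) (c 0) (c t) < t"
proof -
  have "riemannian_dist stiefel (stiefel_metric \<beta>) (c 0) (c t) \<le> \<bar>t - 2 * T\<bar>"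
    using riemannian_dist_constant_speed_le[OF assms(1-5), of "t - 2 * T"] assms(6) by simp
  then show ?thesis
    using assms(7,8) by linarith
qed

lemma cut_time_leI:
  assumes "\<And>t. t > T \<Longrightarrow> t > 0 \<Longrightarrow> riemannian_dist M g (c 0) (c t) < t"
  shows "cut_time M g c \<le> ereal T"
  unfolding cut_time_def
proof (rule Sup_least, clarify)
  fix t :: real
  assume "t > 0" "riemannian_dist M g (c 0) (c t) = t"
  then show "ereal t \<le> ereal T"
    using assms[of t] by force
qed

section \<open>Curves moving two columns\<close>

definition two_columns :: "'p \<Rightarrow> 'p \<Rightarrow> real^'n \<Rightarrow> real^'n \<Rightarrow> real^'p^'n" where
  "two_columns i j v w = (\<chi> r k. if k = i then v $ r else if k = j then w $ r else 0)"

text \<open>The 2 by 2 matrix with rows \<open>(a, b)\<close> and \<open>(c, d)\<close>, placed at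
  the indices \<open>i, j\<close> and extended by zero.\<close>

definition two_block :: "'p \<Rightarrow> 'p \<Rightarrow> real \<Rightarrow> real \<Rightarrow> real \<Rightarrow> real \<Rightarrow> real^'p^'p" where
  "two_block i j a b c d = two_columns i j (a *\<^sub>R axis i 1 + c *\<^sub>R axis j 1) (b *\<^sub>R axis i 1 + d *\<^sub>R axis j 1)"

definition two_frame ::
    "'p \<Rightarrow> 'p \<Rightarrow> real^('p + 'q) \<Rightarrow> real^('p + 'q) \<Rightarrow> real^'p^('p::finite + 'q::finite)" where
  "two_frame i j v w =
    two_columns i j v w + (\<chi> r k. if k = i \<or> k = j then 0 else axis (Inl k) 1 $ r)"

text \<open>Orthogonality to the columns that \<open>two_frame i j\<close> keeps fixed.\<close>

definition avoids_other_axes :: "'p \<Rightarrow> 'p \<Rightarrow> real^('p::finite + 'q::finite) \<Rightarrow> bool" where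
  "avoids_other_axes i j v \<longleftrightarrow> (\<forall>k. k \<noteq> i \<and> k \<noteq> j \<longrightarrow> v $ Inl k = 0)"

lemma column_two_columns:
  "column k (two_columns i j v w) = (if k = i then v else if k = j then w else 0)"
  by (simp add: two_columns_def column_def vec_eq_iff)

lemma column_two_frame:
  "column k (two_frame i j v w) = (if k = i then v else if k = j then w else axis (Inl k) 1)"
  by (simp add: two_frame_def two_columns_def column_def vec_eq_iff)

lemma two_block_nth:
  "two_block i j a b c d $ k $ l =
    (if l = i then if k = i then a else if k = j then c else 0
     else if l = j then if k = i then b else if k = j then d else 0
     else 0)" if "i \<noteq> j"
  using that by (simp add: two_block_def two_columns_def axis_def)

lemma matrix_eq_column:
  fixes X Y :: "'a^'p^'n"
  shows "X = Y \<longleftrightarrow> (\<forall>k. column k X = column k Y)"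
  by (auto simp: column_def vec_eq_iff)

lemma column_matrix_mult:
  fixes X :: "real^'p^'n" and Y :: "real^'m^'p"
  shows "column k (X ** Y) = X *v column k Y"
  by (simp add: matrix_matrix_mult_def matrix_vector_mult_def column_def vec_eq_iff)

lemma mult_two_block:
  fixes X :: "real^'p^'n"
  assumes "i \<noteq> j"
  shows "X ** two_block i j a b c d =
    two_columns i j (a *\<^sub>R column i X + c *\<^sub>R column j X) (b *\<^sub>R column i X + d *\<^sub>R column j X)"
  unfolding matrix_eq_column column_matrix_mult two_block_def
  using assms by (simp add: column_two_columns matrix_vector_right_distrib matrix_vector_mult_basis
      matrix_vector_mult_scaleR)

lemma transpose_two_block:
  "i \<noteq> j \<Longrightarrow> transpose (two_block i j a b c d) = two_block i j a c b d"
  by (simp add: two_block_nth transpose_def vec_eq_iff)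

lemma inner_two_columns:
  assumes "i \<noteq> j"
  shows "two_columns i j v w \<bullet> two_columns i j v w = v \<bullet> v + w \<bullet> w"
proof -
  have "two_columns i j v w \<bullet> two_columns i j v w =
      (\<Sum>k\<in>UNIV. column k (two_columns i j v w) \<bullet> column k (two_columns i j v w))"
    unfolding trace_transpose_mult_inner[symmetric] trace_def transpose_mult_component ..
  also have "\<dots> = (\<Sum>k\<in>{i, j}. if k = i then v \<bullet> v else w \<bullet> w)"
    by (rule sum.mono_neutral_cong_right) (auto simp: column_two_columns)
  also have "\<dots> = v \<bullet> v + w \<bullet> w"
    using assms by simp
  finally show ?thesis .
qed

lemma inner_two_block:
  assumes "i \<noteq> j"
  shows "two_block i j a b c d \<bullet> two_block i j a b c d = a\<^sup>2 + b\<^sup>2 + c\<^sup>2 + d\<^sup>2"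
  using assms by (simp add: two_block_def inner_two_columns inner_add_left inner_add_right inner_axis_axis power2_eq_square)

lemma two_frame_mem_stiefel:
  fixes v w :: "real^('p::finite + 'q::finite)"
  assumes "avoids_other_axes i j v" "avoids_other_axes i j w"
    "v \<bullet> v = 1" "w \<bullet> w = 1" "v \<bullet> w = 0"
  shows "two_frame i j v w \<in> stiefel"
  unfolding stiefel_iff_column
proof (intro allI)
  have ax: "(axis (Inl k) 1 :: real^('p + 'q)) $ Inl l = (if k = l then 1 else 0)" for k l
    by (simp add: axis_def)
  show "column k (two_frame i j v w) \<bullet> column l (two_frame i j v w) = (if k = l then 1 else 0)" for k l
    using assms by (cases "k = i"; cases "k = j"; cases "l = i"; cases "l = j")
      (simp_all add: column_two_frame avoids_other_axes_def inner_axis inner_axis' inner_commute ax)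
qed

lemma transpose_two_frame_mult:
  assumes "i \<noteq> j" "avoids_other_axes i j v'" "avoids_other_axes i j w'"
  shows "transpose (two_frame i j v w) ** two_columns i j v' w' =
    two_block i j (v \<bullet> v') (v \<bullet> w') (w \<bullet> v') (w \<bullet> w')"
proof -
  have "(transpose (two_frame i j v w) ** two_columns i j v' w') $ k $ l =
    two_block i j (v \<bullet> v') (v \<bullet> w') (w \<bullet> v') (w \<bullet> w') $ k $ l" for k l
    unfolding transpose_mult_component column_two_frame column_two_columns
    using assms by (cases "k = i"; cases "k = j"; cases "l = i"; cases "l = j")
      (simp_all add: two_block_nth avoids_other_axes_def inner_axis')
  then show ?thesis
    by (simp add: vec_eq_iff)
qed

lemma two_frame_has_vector_derivative:
  fixes v w :: "real \<Rightarrow> real^('p::finite + 'q::finite)"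
  assumes "(v has_vector_derivative v') (at t)" "(w has_vector_derivative w') (at t)"
  shows "((\<lambda>t. two_frame i j (v t) (w t)) has_vector_derivative two_columns i j v' w') (at t)"
    "((\<lambda>t. two_columns i j (v t) (w t)) has_vector_derivative two_columns i j v' w') (at t)"
proof -
  have "linear (\<lambda>z :: (real^('p + 'q)) \<times> (real^('p + 'q)). two_columns i j (fst z) (snd z))"
    by (rule linearI) (auto simp: two_columns_def vec_eq_iff)
  then have "bounded_linear (\<lambda>z :: (real^('p + 'q)) \<times> (real^('p + 'q)). two_columns i j (fst z) (snd z))"
    by (simp add: linear_conv_bounded_linear)
  from bounded_linear.has_vector_derivative[OF this has_vector_derivative_Pair[OF assms]]
  show 1: "((\<lambda>t. two_columns i j (v t) (w t)) has_vector_derivative two_columns i j v' w') (at t)"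
    by simp
  show "((\<lambda>t. two_frame i j (v t) (w t)) has_vector_derivative two_columns i j v' w') (at t)"
    unfolding two_frame_def using 1 by (auto intro!: derivative_eq_intros)
qed

lemma stiefel_metric_ext_two_frame:
  assumes "i \<noteq> j" "avoids_other_axes i j v'" "avoids_other_axes i j w'"
  shows "stiefel_metric_ext \<beta> (two_frame i j v w) (two_columns i j v' w') (two_columns i j v' w') =
    v' \<bullet> v' + w' \<bullet> w' + (\<beta> - 1) * ((v \<bullet> v')\<^sup>2 + (v \<bullet> w')\<^sup>2 + (w \<bullet> v')\<^sup>2 + (w \<bullet> w')\<^sup>2)"
  by (simp add: stiefel_metric_ext_inner transpose_two_frame_mult inner_two_block inner_two_columns assms)

text \<open>The hypotheses of \<open>stiefel_geodesicI\<close> and unit speed, written out for two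
  moving columns. The symmetric matrices are diagonal: \<open>a, b\<close> give the acceleration,
  and \<open>r, s\<close> give the product of the velocity with
  \<open>transpose (curve t) ** curve' t\<close>.\<close>

locale unit_speed_two_frame =
  fixes \<beta> a b r s :: real and i j :: "'p::finite"
    and v w v' w' :: "real \<Rightarrow> real^('p + 'q::finite)"
  assumes beta_pos: "\<beta> > 0" and neq: "i \<noteq> j"
    and avoids: "\<And>t. avoids_other_axes i j (v t)" "\<And>t. avoids_other_axes i j (w t)"
      "\<And>t. avoids_other_axes i j (v' t)" "\<And>t. avoids_other_axes i j (w' t)"
    and orthonormal: "\<And>t. v t \<bullet> v t = 1" "\<And>t. w t \<bullet> w t = 1" "\<And>t. v t \<bullet> w t = 0"
    and deriv: "\<And>t. (v has_vector_derivative v' t) (at t)"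
      "\<And>t. (w has_vector_derivative w' t) (at t)"
      "\<And>t. (v' has_vector_derivative a *\<^sub>R v t) (at t)"
      "\<And>t. (w' has_vector_derivative b *\<^sub>R w t) (at t)"
    and rotation: "\<And>t. (v t \<bullet> v' t) *\<^sub>R v' t + (w t \<bullet> v' t) *\<^sub>R w' t = r *\<^sub>R v t"
      "\<And>t. (v t \<bullet> w' t) *\<^sub>R v' t + (w t \<bullet> w' t) *\<^sub>R w' t = s *\<^sub>R w t"
    and speed: "\<And>t. v' t \<bullet> v' t + w' t \<bullet> w' t + (\<beta> - 1) *
      ((v t \<bullet> v' t)\<^sup>2 + (v t \<bullet> w' t)\<^sup>2 + (w t \<bullet> v' t)\<^sup>2 + (w t \<bullet> w' t)\<^sup>2) = 1"
begin

definition curve :: "real \<Rightarrow> real^'p^('p + 'q)" where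
  "curve t = two_frame i j (v t) (w t)"

definition curve' :: "real \<Rightarrow> real^'p^('p + 'q)" where
  "curve' t = two_columns i j (v' t) (w' t)"

lemma curve_mem_stiefel: "curve t \<in> stiefel"
  unfolding curve_def by (intro two_frame_mem_stiefel avoids orthonormal)

lemma curve_has_vector_derivative: "(curve has_vector_derivative curve' t) (at t)"
  unfolding curve_def[abs_def] curve'_def by (intro two_frame_has_vector_derivative deriv)

lemma curve'_has_vector_derivative:
  "(curve' has_vector_derivative two_columns i j (a *\<^sub>R v t) (b *\<^sub>R w t)) (at t)"
  unfolding curve'_def[abs_def] by (intro two_frame_has_vector_derivative deriv)

lemma continuous_curve': "continuous_on UNIV curve'"
  using curve'_has_vector_derivative has_vector_derivative_continuous
  by (blast intro: continuous_at_imp_continuous_on)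

lemma curve_unit_speed: "stiefel_metric_ext \<beta> (curve t) (curve' t) (curve' t) = 1"
  unfolding curve_def curve'_def using neq avoids speed by (simp add: stiefel_metric_ext_two_frame)

lemma geodesic_curve: "is_geodesic stiefel stiefel_tangent (stiefel_metric \<beta>) curve"
proof (rule stiefel_geodesicI)
  show "two_columns i j (a *\<^sub>R v t) (b *\<^sub>R w t) = curve t ** two_block i j a 0 0 b" for t
    using neq by (simp add: curve_def mult_two_block column_two_frame)
  show "curve' t ** (transpose (curve t) ** curve' t) = curve t ** two_block i j r 0 0 s" for t
    using neq by (simp add: curve_def curve'_def transpose_two_frame_mult avoids mult_two_block
        column_two_frame column_two_columns rotation)
qed (use neq in \<open>simp_all add: beta_pos transpose_two_block curve_mem_stiefel
       curve_has_vector_derivative curve'_has_vector_derivative\<close>)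

lemma injectivity_radius_leI:
  assumes "\<And>t. t > T \<Longrightarrow> t > 0 \<Longrightarrow>
    riemannian_dist stiefel (stiefel_metric \<beta>) (curve 0) (curve t) < t"
  shows "injectivity_radius (stiefel :: (real^'p^('p + 'q)) set) stiefel_tangent (stiefel_metric \<beta>) \<le> ereal T"
  using injectivity_radius_le_cut_time[OF beta_pos geodesic_curve curve_has_vector_derivative curve_unit_speed]
    cut_time_leI[of T stiefel "stiefel_metric \<beta>" curve] assms
  by (meson order_trans)

lemma dist_periodic_less:
  assumes "\<And>t. v (t - 2 * T) = v t" "\<And>t. w (t - 2 * T) = w t" "T > 0" "T < t"
  shows "riemannian_dist stiefel (stiefel_metric \<beta>) (curve 0) (curve t) < t"
  using assms
  by (intro riemannian_dist_periodic_less[OF beta_pos curve_mem_stiefel curve_has_vector_derivative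
      continuous_curve' curve_unit_speed]) (simp_all add: curve_def)

end

section \<open>Helices in a Berger sphere\<close>

text \<open>Coordinates on the 4-dimensional space in which all moving columns stay; distinct
  \<open>i, j\<close> and distinct \<open>k, l\<close> exist because \<open>p\<close> and
  \<open>n - p\<close> are at least 2.\<close>

definition plane_vec ::
    "'p \<Rightarrow> 'p \<Rightarrow> 'q \<Rightarrow> 'q \<Rightarrow> real \<Rightarrow> real \<Rightarrow> real \<Rightarrow> real \<Rightarrow> real^('p::finite + 'q::finite)" where
  "plane_vec i j k l a b c d =
    a *\<^sub>R axis (Inl i) 1 + b *\<^sub>R axis (Inl j) 1 + c *\<^sub>R axis (Inr k) 1 + d *\<^sub>R axis (Inr l) 1"

lemma avoids_plane_vec: "avoids_other_axes i j (plane_vec i j k l a b c d)"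
  by (simp add: avoids_other_axes_def plane_vec_def axis_def)

lemma inner_plane_vec:
  assumes "i \<noteq> j" "k \<noteq> l"
  shows "plane_vec i j k l a b c d \<bullet> plane_vec i j k l a' b' c' d' = a * a' + b * b' + c * c' + d * d'"
  using assms by (simp add: plane_vec_def inner_add_left inner_add_right inner_axis_axis)

lemma scaleR_plane_vec:
  "r *\<^sub>R plane_vec i j k l a b c d = plane_vec i j k l (r * a) (r * b) (r * c) (r * d)"
  by (simp add: plane_vec_def scaleR_add_right)

lemma plane_vec_add:
  "plane_vec i j k l a b c d + plane_vec i j k l a' b' c' d' =
    plane_vec i j k l (a + a') (b + b') (c + c') (d + d')"
  by (simp add: plane_vec_def scaleR_add_left)

lemma has_vector_derivative_plane_vec:
  fixes i j :: "'p::finite" and k l :: "'q::finite"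
  assumes "(a has_real_derivative a') (at t)" "(b has_real_derivative b') (at t)"
    "(c has_real_derivative c') (at t)" "(d has_real_derivative d') (at t)"
  shows "((\<lambda>t. plane_vec i j k l (a t) (b t) (c t) (d t)) has_vector_derivative
    plane_vec i j k l a' b' c' d') (at t)"
proof -
  have "((\<lambda>t. f t *\<^sub>R X) has_vector_derivative f' *\<^sub>R X) (at t)"
    if "(f has_real_derivative f') (at t)" for f f' and X :: "real^('p + 'q)"
    using has_vector_derivative_scaleR[OF that has_vector_derivative_const[of X]] by simp
  then show ?thesis
    unfolding plane_vec_def using assms by (intro has_vector_derivative_add) auto
qed

lemma continuous_on_plane_vec:
  assumes "continuous_on S a" "continuous_on S b" "continuous_on S c" "continuous_on S d"
  shows "continuous_on S (\<lambda>t. plane_vec i j k l (a t) (b t) (c t) (d t))"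
  unfolding plane_vec_def by (intro continuous_intros assms)

text \<open>
  With \<open>x = a + \<i> b\<close> and \<open>y = c + \<i> d\<close>, the two moving columns form the real \<open>4 \<times> 2\<close> matrix of the complex
  column \<open>(x, y)\<close>. These frames form a sphere of dimension 3 in \<open>stiefel\<close>, on which the metric is a
  Berger metric.
\<close>

definition sphere_frame ::
    "'p \<Rightarrow> 'p \<Rightarrow> 'q \<Rightarrow> 'q \<Rightarrow> real \<Rightarrow> real \<Rightarrow> real \<Rightarrow> real \<Rightarrow> real^'p^('p::finite + 'q::finite)" where
  "sphere_frame i j k l a b c d =
    two_frame i j (plane_vec i j k l a b c d) (plane_vec i j k l (- b) a (- d) c)"

text \<open>The second moving column is the first multiplied by the imaginary unit, so both
  contribute the same squared norm. The only nonzero entries of the skew block are plus and minus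
  the component of the velocity along the Hopf fibre, and \<beta> rescales exactly this
  component.\<close>

lemma riemannian_dist_sphere_frame_le:
  fixes a b c d a' b' c' d' :: "real \<Rightarrow> real" and i j :: "'p::finite" and k l :: "'q::finite"
  assumes "\<beta> > 0" and neq: "i \<noteq> j" "k \<noteq> l"
    and deriv: "\<And>t. (a has_real_derivative a' t) (at t)" "\<And>t. (b has_real_derivative b' t) (at t)"
      "\<And>t. (c has_real_derivative c' t) (at t)" "\<And>t. (d has_real_derivative d' t) (at t)"
    and cont: "continuous_on UNIV a'" "continuous_on UNIV b'" "continuous_on UNIV c'" "continuous_on UNIV d'"
    and unit: "\<And>t. (a t)\<^sup>2 + (b t)\<^sup>2 + (c t)\<^sup>2 + (d t)\<^sup>2 = 1"
    and speed: "\<And>t. 2 * ((a' t)\<^sup>2 + (b' t)\<^sup>2 + (c' t)\<^sup>2 + (d' t)\<^sup>2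
        + (\<beta> - 1) * (a t * b' t - b t * a' t + c t * d' t - d t * c' t)\<^sup>2) = L\<^sup>2"
    and "L \<ge> 0"
  shows "riemannian_dist stiefel (stiefel_metric \<beta>)
    (sphere_frame i j k l (a 0) (b 0) (c 0) (d 0)) (sphere_frame i j k l (a 1) (b 1) (c 1) (d 1)) \<le> L"
proof -
  have orth: "a t * a' t + b t * b' t + c t * c' t + d t * d' t = 0" for t
  proof -
    have "((\<lambda>t. (a t)\<^sup>2 + (b t)\<^sup>2 + (c t)\<^sup>2 + (d t)\<^sup>2) has_real_derivative
        2 * (a t * a' t + b t * b' t + c t * c' t + d t * d' t)) (at t)"
      by (auto intro!: derivative_eq_intros deriv simp: algebra_simps)
    moreover have "((\<lambda>t. (a t)\<^sup>2 + (b t)\<^sup>2 + (c t)\<^sup>2 + (d t)\<^sup>2) has_real_derivative 0) (at t)"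
      by (simp add: unit)
    ultimately show ?thesis
      using DERIV_unique by fastforce
  qed
  define V where "V t = plane_vec i j k l (a t) (b t) (c t) (d t)" for t
  define W where "W t = plane_vec i j k l (- b t) (a t) (- d t) (c t)" for t
  define V' where "V' t = plane_vec i j k l (a' t) (b' t) (c' t) (d' t)" for t
  define W' where "W' t = plane_vec i j k l (- b' t) (a' t) (- d' t) (c' t)" for t
  have dV: "(V has_vector_derivative V' t) (at t)" and dW: "(W has_vector_derivative W' t) (at t)" for t
    unfolding V_def[abs_def] V'_def W_def[abs_def] W'_def
    by (intro has_vector_derivative_plane_vec deriv DERIV_minus)+
  have eqs: "V' t \<bullet> V' t = (a' t)\<^sup>2 + (b' t)\<^sup>2 + (c' t)\<^sup>2 + (d' t)\<^sup>2"
    "W' t \<bullet> W' t = (a' t)\<^sup>2 + (b' t)\<^sup>2 + (c' t)\<^sup>2 + (d' t)\<^sup>2"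
    "V t \<bullet> V' t = 0" "W t \<bullet> W' t = 0"
    "W t \<bullet> V' t = a t * b' t - b t * a' t + c t * d' t - d t * c' t"
    "V t \<bullet> W' t = - (a t * b' t - b t * a' t + c t * d' t - d t * c' t)" for t
    using orth[of t]
    by (simp_all add: V_def V'_def W_def W'_def inner_plane_vec neq power2_eq_square algebra_simps)
  have "riemannian_dist stiefel (stiefel_metric \<beta>) (two_frame i j (V 0) (W 0)) (two_frame i j (V 1) (W 1)) \<le> L"
  proof (rule riemannian_dist_stiefel_le[where c = "\<lambda>t. two_frame i j (V t) (W t)"
        and c' = "\<lambda>t. two_columns i j (V' t) (W' t)"])
    show "two_frame i j (V t) (W t) \<in> stiefel" for t
      using unit[of t] by (intro two_frame_mem_stiefel)
        (simp_all add: V_def W_def avoids_plane_vec inner_plane_vec neq power2_eq_square algebra_simps)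
    show "continuous_on UNIV (\<lambda>t. two_columns i j (V' t) (W' t))"
    proof -
      have "continuous_on UNIV V'" "continuous_on UNIV W'"
        unfolding V'_def[abs_def] W'_def[abs_def]
        by (intro continuous_on_plane_vec continuous_on_minus cont)+
      then have "continuous_on UNIV (\<lambda>t. if k = i then V' t $ r else if k = j then W' t $ r else 0)" for r k
        by (cases "k = i"; cases "k = j") (simp_all add: continuous_on_component)
      then show ?thesis
        unfolding two_columns_def by (intro continuous_on_vec_lambda)
    qed
    show "stiefel_metric_ext \<beta> (two_frame i j (V t) (W t)) (two_columns i j (V' t) (W' t))
        (two_columns i j (V' t) (W' t)) = L\<^sup>2" for t
    proof -
      have "avoids_other_axes i j (V' t)" "avoids_other_axes i j (W' t)"
        by (simp_all add: V'_def W'_def avoids_plane_vec)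
      then show ?thesis
        unfolding stiefel_metric_ext_two_frame[OF neq(1) \<open>avoids_other_axes i j (V' t)\<close>
            \<open>avoids_other_axes i j (W' t)\<close>] eqs power2_minus speed[of t, symmetric]
        by (simp add: algebra_simps)
    qed
  qed (use assms dV dW in \<open>auto intro: two_frame_has_vector_derivative\<close>)
  then show ?thesis
    by (simp add: sphere_frame_def V_def W_def)
qed

text \<open>
  The curve is \<open>x(u) = e\<^bsup>\<i>pu\<^esup> (cos (\<omega>u) + \<i> \<kappa> sin (\<omega>u))\<close>, \<open>y(u) = \<eta> e\<^bsup>\<i>p(u - 1)\<^esup> sin (\<omega>u)\<close>, the shape of a
  geodesic of the Berger sphere, except that \<open>p\<close> is free; its speed is constant for every \<open>p\<close>.
\<close>

lemma riemannian_dist_helix_le: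
  fixes i j :: "'p::finite" and k l :: "'q::finite"
  assumes "\<beta> > 0" "i \<noteq> j" "k \<noteq> l" and \<kappa>\<eta>: "\<kappa>\<^sup>2 + \<eta>\<^sup>2 = 1"
    and end1: "cos p * cos \<omega> - \<kappa> * sin p * sin \<omega> = x" "sin p * cos \<omega> + \<kappa> * cos p * sin \<omega> = 0"
      "\<eta> * sin \<omega> = y"
  shows "riemannian_dist stiefel (stiefel_metric \<beta>)
    (sphere_frame i j k l 1 0 0 0) (sphere_frame i j k l x 0 y 0)
    \<le> sqrt (2 * (\<beta> * (p + \<kappa> * \<omega>)\<^sup>2 + (\<eta> * \<omega>)\<^sup>2))"
proof -
  define a b c d where "a u = cos (p * u) * cos (\<omega> * u) - \<kappa> * sin (p * u) * sin (\<omega> * u)"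
    and "b u = sin (p * u) * cos (\<omega> * u) + \<kappa> * cos (p * u) * sin (\<omega> * u)"
    and "c u = \<eta> * cos (p * (u - 1)) * sin (\<omega> * u)"
    and "d u = \<eta> * sin (p * (u - 1)) * sin (\<omega> * u)" for u
  define m n where "m u = - (\<omega> + p * \<kappa>) * sin (\<omega> * u)" and "n u = (p + \<kappa> * \<omega>) * cos (\<omega> * u)" for u
  define a' b' c' d' where "a' u = cos (p * u) * m u - sin (p * u) * n u"
    and "b' u = sin (p * u) * m u + cos (p * u) * n u"
    and "c' u = \<eta> * (\<omega> * cos (p * (u - 1)) * cos (\<omega> * u) - p * sin (p * (u - 1)) * sin (\<omega> * u))"
    and "d' u = \<eta> * (\<omega> * sin (p * (u - 1)) * cos (\<omega> * u) + p * cos (p * (u - 1)) * sin (\<omega> * u))" for u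
  note defs = a_def b_def c_def d_def a'_def b'_def c'_def d'_def m_def n_def
  define L where "L = sqrt (2 * (\<beta> * (p + \<kappa> * \<omega>)\<^sup>2 + (\<eta> * \<omega>)\<^sup>2))"
  have "riemannian_dist stiefel (stiefel_metric \<beta>)
    (sphere_frame i j k l (a 0) (b 0) (c 0) (d 0)) (sphere_frame i j k l (a 1) (b 1) (c 1) (d 1)) \<le> L"
  proof (rule riemannian_dist_sphere_frame_le[where a' = a' and b' = b' and c' = c' and d' = d'])
    fix u
    show "(a has_real_derivative a' u) (at u)" "(b has_real_derivative b' u) (at u)"
      "(c has_real_derivative c' u) (at u)" "(d has_real_derivative d' u) (at u)"
      unfolding defs[abs_def] by (auto intro!: derivative_eq_intros simp: algebra_simps)
    have p: "(cos (p * u))\<^sup>2 + (sin (p * u))\<^sup>2 = 1"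
      "(cos (p * (u - 1)))\<^sup>2 + (sin (p * (u - 1)))\<^sup>2 = 1" "(cos (\<omega> * u))\<^sup>2 + (sin (\<omega> * u))\<^sup>2 = 1"
      by simp_all
    have "(a u)\<^sup>2 + (b u)\<^sup>2 = (cos (\<omega> * u))\<^sup>2 + \<kappa>\<^sup>2 * (sin (\<omega> * u))\<^sup>2"
      unfolding defs using p(1) by algebra
    moreover have "(c u)\<^sup>2 + (d u)\<^sup>2 = \<eta>\<^sup>2 * (sin (\<omega> * u))\<^sup>2"
      unfolding defs using p(2) by algebra
    ultimately show "(a u)\<^sup>2 + (b u)\<^sup>2 + (c u)\<^sup>2 + (d u)\<^sup>2 = 1"
      using p(3) \<kappa>\<eta> by algebra
    have "(a' u)\<^sup>2 + (b' u)\<^sup>2 = (m u)\<^sup>2 + (n u)\<^sup>2"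
      unfolding a'_def b'_def using p(1) by algebra
    moreover have "(c' u)\<^sup>2 + (d' u)\<^sup>2 = \<eta>\<^sup>2 * (\<omega>\<^sup>2 * (cos (\<omega> * u))\<^sup>2 + p\<^sup>2 * (sin (\<omega> * u))\<^sup>2)"
      unfolding defs using p(2) by algebra
    \<comment> \<open>The coefficients of the squared cosine and the squared sine agree because
      \<kappa>, \<eta> lie on the unit circle; hence the speed is constant.\<close>
    ultimately have 1: "(a' u)\<^sup>2 + (b' u)\<^sup>2 + (c' u)\<^sup>2 + (d' u)\<^sup>2 = (p + \<kappa> * \<omega>)\<^sup>2 + (\<eta> * \<omega>)\<^sup>2"
      using p(3) \<kappa>\<eta> unfolding m_def n_def by algebra
    have "a u * b' u - b u * a' u = cos (\<omega> * u) * n u - \<kappa> * sin (\<omega> * u) * m u"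
      unfolding a'_def b'_def a_def b_def using p(1) by algebra
    moreover have "c u * d' u - d u * c' u = \<eta>\<^sup>2 * p * (sin (\<omega> * u))\<^sup>2"
      unfolding defs using p(2) by algebra
    \<comment> \<open>The component along the Hopf fibre is constant as well, so the horizontal part
      of the squared speed is \<open>(\<eta> * \<omega>)\<^sup>2\<close>.\<close>
    ultimately have 2: "a u * b' u - b u * a' u + c u * d' u - d u * c' u = p + \<kappa> * \<omega>"
      using p(3) \<kappa>\<eta> unfolding m_def n_def by algebra
    show "2 * ((a' u)\<^sup>2 + (b' u)\<^sup>2 + (c' u)\<^sup>2 + (d' u)\<^sup>2
        + (\<beta> - 1) * (a u * b' u - b u * a' u + c u * d' u - d u * c' u)\<^sup>2) = L\<^sup>2"
      unfolding 1 2 L_def using assms(1) by (simp add: algebra_simps)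
  next
    show "continuous_on UNIV a'" "continuous_on UNIV b'" "continuous_on UNIV c'" "continuous_on UNIV d'"
      unfolding defs[abs_def] by (intro continuous_intros)+
    show "L \<ge> 0"
      unfolding L_def using assms(1) by simp
  qed fact+
  moreover have "a 0 = 1" "b 0 = 0" "c 0 = 0" "d 0 = 0" "a 1 = x" "b 1 = 0" "c 1 = y" "d 1 = 0"
    using end1 by (simp_all add: defs)
  ultimately show ?thesis
    by (simp add: L_def)
qed

section \<open>The number t_r\<close>

text \<open>Multiplying the defining equation by \<beta> t gives a function \<open>F\<close> that is
  positive up to \<open>pi / 2\<close>, strictly decreasing on \<open>[pi / 2, pi]\<close> and
  negative at \<open>pi\<close>. Its only zero up to \<open>pi\<close> is therefore
  \<open>t_r \<beta>\<close>.\<close>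

lemma
  assumes "0 < \<beta>" "\<beta> < 1"
  shows t_r_gt_half_pi: "pi / 2 < t_r \<beta>"
    and t_r_less_imp_neg: "t_r \<beta> < s \<Longrightarrow> s \<le> pi \<Longrightarrow> \<beta> * sin s + (1 - \<beta>) * (s * cos s) < 0"
proof -
  define F where "F t = \<beta> * sin t + (1 - \<beta>) * (t * cos t)" for t
  have eq: "sin t / t + (1 - \<beta>) / \<beta> * cos t = 0 \<longleftrightarrow> F t = 0" if "t > 0" for t
    using that assms by (auto simp: F_def field_simps)
  have pos: "F t > 0" if "0 < t" "t \<le> pi / 2" for t
  proof -
    have "sin t > 0" "cos t \<ge> 0"
      using that by (auto intro!: sin_gt_zero cos_ge_zero)
    then show ?thesis
      unfolding F_def using assms that by (intro add_pos_nonneg) auto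
  qed
  have dec: "F t < F u" if "pi / 2 \<le> u" "u < t" "t \<le> pi" for t u
  proof (rule DERIV_neg_imp_decreasing_open[OF that(2)])
    fix x assume x: "u < x" "x < t"
    have "(F has_real_derivative cos x - (1 - \<beta>) * (x * sin x)) (at x)"
      unfolding F_def[abs_def] by (auto intro!: derivative_eq_intros simp: algebra_simps)
    moreover have "cos x < 0"
      using x that cos_monotone_0_pi[of "pi / 2" x] by auto
    moreover have "sin x > 0"
      using x that pi_gt_zero by (intro sin_gt_zero) linarith+
    then have "(1 - \<beta>) * (x * sin x) > 0"
      using x that assms pi_gt_zero by (intro mult_pos_pos) linarith+
    ultimately show "\<exists>y. (F has_real_derivative y) (at x) \<and> y < 0"
      by (intro exI[of _ "cos x - (1 - \<beta>) * (x * sin x)"]) linarith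
  qed (auto simp: F_def intro!: continuous_intros)
  have "\<exists>t\<ge>pi / 2. t \<le> pi \<and> F t = 0"
    by (rule IVT2') (use assms pos[of "pi / 2"] pi_gt_zero in \<open>auto simp: F_def intro!: continuous_intros\<close>)
  then obtain t0 where t0: "pi / 2 \<le> t0" "t0 \<le> pi" "F t0 = 0"
    by blast
  then have "pi / 2 < t0"
    using pos[of "pi / 2"] pi_gt_zero by (cases "t0 = pi / 2") auto
  have "t_r \<beta> = t0"
    unfolding t_r_def
  proof (rule Least_equality)
    show "t0 > 0 \<and> sin t0 / t0 + (1 - \<beta>) / \<beta> * cos t0 = 0"
      using t0 \<open>pi / 2 < t0\<close> eq[of t0] pi_gt_zero by linarith
    fix t assume t: "t > 0 \<and> sin t / t + (1 - \<beta>) / \<beta> * cos t = 0"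
    then have "F t = 0"
      using eq by blast
    then show "t0 \<le> t"
      using pos[of t] dec[of t t0] t t0 by force
  qed
  then show "pi / 2 < t_r \<beta>"
    using \<open>pi / 2 < t0\<close> by simp
  show "\<beta> * sin s + (1 - \<beta>) * (s * cos s) < 0" if "t_r \<beta> < s" "s \<le> pi"
    using dec[of t0 s] that t0 \<open>t_r \<beta> = t0\<close> by (simp add: F_def)
qed

text \<open>For \<beta> \<ge> 1 the function \<open>F\<close> is positive on the open interval from
  0 to \<open>pi\<close>. Up to \<open>pi / 2\<close> this follows from
  \<open>sin t > t * cos t\<close>; beyond it both summands have the right sign.\<close>

lemma t_r_ge_pi:
  assumes "\<beta> \<ge> 1"
  shows "pi \<le> t_r \<beta>"
proof -
  define F where "F t = \<beta> * sin t + (1 - \<beta>) * (t * cos t)" for t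
  have cont: "continuous_on S F" for S
    unfolding F_def by (intro continuous_intros)
  have eq: "sin t / t + (1 - \<beta>) / \<beta> * cos t = 0 \<longleftrightarrow> F t = 0" if "t > 0" for t
    using that assms by (auto simp: F_def field_simps)
  have pos: "F t > 0" if t: "0 < t" "t < pi" for t
  proof (cases "t \<le> pi / 2")
    case True
    have "sin 0 - 0 * cos 0 < sin t - t * cos t"
    proof (rule DERIV_pos_imp_increasing_open[OF t(1)])
      fix x assume x: "0 < x" "x < t"
      have "((\<lambda>t. sin t - t * cos t) has_real_derivative x * sin x) (at x)"
        by (auto intro!: derivative_eq_intros)
      moreover have "x * sin x > 0"
        using x t by (intro mult_pos_pos sin_gt_zero) auto
      ultimately show "\<exists>y. ((\<lambda>t. sin t - t * cos t) has_real_derivative y) (at x) \<and> 0 < y"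
        by blast
    qed (auto intro!: continuous_intros)
    then have "\<beta> * (sin t - t * cos t) > 0"
      using assms by simp
    moreover have "t * cos t \<ge> 0"
      using t True by (auto intro!: mult_nonneg_nonneg cos_ge_zero)
    ultimately show ?thesis
      by (simp add: F_def algebra_simps)
  next
    case False
    then have "cos t < 0"
      using t cos_monotone_0_pi[of "pi / 2" t] by auto
    then have "t * cos t \<le> 0"
      using t by (simp add: mult_nonneg_nonpos)
    then have "(1 - \<beta>) * (t * cos t) \<ge> 0"
      using assms by (simp add: mult_nonpos_nonpos)
    moreover have "\<beta> * sin t > 0"
      using t assms sin_gt_zero by simp
    ultimately show ?thesis
      by (simp add: F_def)
  qed
  \<comment> \<open>\<open>LEAST\<close> is informative only if a minimum exists. The zeros in this
    interval form a compact set, nonempty by the sign change between \<open>pi\<close> and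
    \<open>3 / 2 * pi\<close>.\<close>
  define Z where "Z = {t \<in> {pi..3 / 2 * pi}. F t = 0}"
  have "F (3 / 2 * pi) = - \<beta>"
    by (simp only: F_def sin_3over2_pi cos_3over2_pi)
  moreover have "F pi \<ge> 0"
    using assms by (simp add: F_def mult_nonpos_nonneg)
  ultimately have "\<exists>t\<ge>pi. t \<le> 3 / 2 * pi \<and> F t = 0"
    using assms by (intro IVT2' cont) auto
  then have "Z \<noteq> {}"
    by (auto simp: Z_def)
  moreover have "closed Z"
    unfolding Z_def by (intro continuous_closed_preimage_constant cont closed_atLeastAtMost)
  moreover have "bounded Z"
    by (rule bounded_subset[OF bounded_closed_interval[of pi "3 / 2 * pi"]]) (auto simp: Z_def)
  ultimately obtain t0 where t0: "t0 \<in> Z" "\<And>t. t \<in> Z \<Longrightarrow> t0 \<le> t"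
    using compact_attains_inf[of Z] by (auto simp: compact_eq_bounded_closed)
  have "t0 > 0"
    using t0(1) pi_gt_zero unfolding Z_def by (smt (verit) atLeastAtMost_iff mem_Collect_eq)
  have "t_r \<beta> = t0"
    unfolding t_r_def
  proof (rule Least_equality)
    show "t0 > 0 \<and> sin t0 / t0 + (1 - \<beta>) / \<beta> * cos t0 = 0"
      using t0(1) eq[OF \<open>t0 > 0\<close>] \<open>t0 > 0\<close> by (auto simp: Z_def)
    fix t assume t: "t > 0 \<and> sin t / t + (1 - \<beta>) / \<beta> * cos t = 0"
    then have F: "F t = 0"
      using eq by blast
    then have "pi \<le> t"
      using pos[of t] t by force
    show "t0 \<le> t"
    proof (cases "t \<le> 3 / 2 * pi")
      case True
      then show ?thesis
        using t0(2)[of t] F \<open>pi \<le> t\<close> by (auto simp: Z_def)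
    next
      case False
      then show ?thesis
        using t0(1) by (auto simp: Z_def)
    qed
  qed
  then show ?thesis
    using t0(1) by (auto simp: Z_def)
qed

text \<open>
  For a helix of frequency \<open>\<omega> = w\<close>, the end point forces \<open>\<eta> = sin s / sin w\<close> and \<open>p = arctan r\<close>.
  Since \<open>arctan r \<le> r\<close>, half the squared length is at most \<open>\<Phi> w\<close>. At \<open>w = s\<close> this is \<open>s\<^sup>2\<close>, the
  value for the geodesic, and the derivative there is positive exactly because \<open>s\<close> is past
  \<open>t_r \<beta>\<close>, so a slightly smaller frequency gives a shorter curve.
\<close>

lemma shorter_helix:
  assumes \<beta>: "0 < \<beta>" "\<beta> < 1" and s: "pi / 2 < s" "s < pi"
    and neg: "\<beta> * sin s + (1 - \<beta>) * (s * cos s) < 0"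
  obtains \<kappa> \<eta> p \<omega> where "\<kappa>\<^sup>2 + \<eta>\<^sup>2 = 1" "cos p * cos \<omega> - \<kappa> * sin p * sin \<omega> = cos s"
    "sin p * cos \<omega> + \<kappa> * cos p * sin \<omega> = 0" "\<eta> * sin \<omega> = sin s"
    "\<beta> * (p + \<kappa> * \<omega>)\<^sup>2 + (\<eta> * \<omega>)\<^sup>2 < s\<^sup>2"
proof -
  define \<Phi> where "\<Phi> w = w\<^sup>2 + (1 - (sin s / sin w)\<^sup>2) * (\<beta> * (w - sin w / cos w)\<^sup>2 - w\<^sup>2)" for w
  define S C where "S = sin s" and "C = cos s"
  have S: "S > 0"
    unfolding S_def using s pi_gt_zero by (intro sin_gt_zero) linarith+
  have C: "C < 0"
    unfolding C_def using s cos_monotone_0_pi[of "pi / 2" s] by auto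
  \<comment> \<open>The derivative of \<Phi> at \<open>s\<close>. The factor
    \<open>1 - (sin s / sin w)\<^sup>2\<close> vanishes there, so the derivative of the other factor
    drops out.\<close>
  define D where "D = 2 * s + 2 * (C / S) * (\<beta> * (s - S / C)\<^sup>2 - s\<^sup>2)"
  have d1: "((\<lambda>w. 1 - (S / sin w)\<^sup>2) has_real_derivative 2 * (C / S)) (at s)"
    using S by (auto intro!: derivative_eq_intros simp: S_def C_def power2_eq_square)
  have d2: "((\<lambda>w. \<beta> * (w - sin w / cos w)\<^sup>2 - w\<^sup>2) has_real_derivative
      \<beta> * (2 * (s - S / C) * (1 - (C * C + S * S) / (C * C))) - 2 * s) (at s)"
    using C by (auto intro!: derivative_eq_intros simp: S_def C_def)
  have "((\<lambda>w. w\<^sup>2) has_real_derivative 2 * s) (at s)"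
    by (auto intro!: derivative_eq_intros)
  from DERIV_add[OF this DERIV_mult[OF d1 d2]]
  have "(\<Phi> has_real_derivative D) (at s)"
    using S by (simp add: \<Phi>_def[abs_def] D_def S_def C_def)
  moreover have "D > 0"
  proof -
    define m where "m = S - s * C"
    have "s > 0"
      using s pi_gt_zero by linarith
    have m: "m > 0"
      using S mult_pos_neg[OF \<open>s > 0\<close> C] by (simp add: m_def)
    \<comment> \<open>This is the hypothesis \<open>neg\<close> rewritten with \<open>m\<close>; it
      fixes the sign of the numerator of \<open>D\<close>.\<close>
    have \<beta>m: "\<beta> * m + s * C < 0"
      using neg by (simp add: m_def S_def C_def algebra_simps)
    have "D = 2 * m * (\<beta> * m + s * C) / (S * C)"
      using S C by (simp add: D_def m_def power2_eq_square field_simps)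
    moreover have "S * C < 0"
      using S C by (simp add: mult_pos_neg)
    moreover have "2 * m * (\<beta> * m + s * C) < 0"
      using m \<beta>m by (simp add: mult_pos_neg)
    ultimately show ?thesis
      by (simp add: divide_neg_neg)
  qed
  ultimately obtain d where d: "d > 0" "\<And>h. h > 0 \<Longrightarrow> h < d \<Longrightarrow> \<Phi> (s - h) < \<Phi> s"
    using DERIV_pos_inc_left by blast
  \<comment> \<open>Halving keeps \<open>h\<close> strictly below both bounds: \<Phi> has decreased
    at \<open>s - h\<close>, and \<open>s - h\<close> stays above \<open>pi / 2\<close>, where the
    cosine is negative and the sine exceeds \<open>sin s\<close>.\<close>
  define h where "h = min d (s - pi / 2) / 2"
  define w where "w = s - h"
  have h: "h > 0" "h < d" "h < s - pi / 2"
    using d(1) s by (auto simp: h_def min_def)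
  have "\<Phi> w < \<Phi> s"
    unfolding w_def using d(2) h by blast
  moreover have "\<Phi> s = s\<^sup>2"
    using S by (simp add: \<Phi>_def S_def)
  ultimately have \<Phi>: "\<Phi> w < s\<^sup>2"
    by simp
  have w: "pi / 2 < w" "w < s" "w > 0"
    using h s pi_gt_zero by (auto simp: w_def)
  have cw: "cos w < 0"
    using w s cos_monotone_0_pi[of "pi / 2" w] by auto
  have sw: "sin s < sin w"
    using w s cos_monotone_0_pi[of "w - pi / 2" "s - pi / 2"] by (simp add: cos_diff)
  have sw0: "sin w > 0"
    using sw S S_def by linarith
  define \<eta> \<kappa> where "\<eta> = sin s / sin w" and "\<kappa> = sqrt (1 - \<eta>\<^sup>2)"
  have \<eta>: "0 < \<eta>" "\<eta> < 1"
    using sw sw0 S by (auto simp: \<eta>_def S_def)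
  then have \<kappa>2: "\<kappa>\<^sup>2 = 1 - \<eta>\<^sup>2"
    by (simp add: \<kappa>_def power_le_one)
  have \<kappa>: "\<kappa> \<ge> 0"
    using \<eta> by (simp add: \<kappa>_def power_le_one)
  \<comment> \<open>The imaginary part of the end point vanishes exactly when
    \<open>tan p = - \<kappa> * tan w\<close>.\<close>
  define r where "r = - \<kappa> * (sin w / cos w)"
  define p where "p = arctan r"
  have r: "r \<ge> 0"
    using \<kappa> sw0 cw by (simp add: r_def divide_nonneg_neg mult_nonneg_nonpos)
  have cp: "cos p > 0"
    by (simp add: p_def cos_arctan add_pos_nonneg)
  have sp: "sin p = r * cos p"
    by (simp add: p_def cos_arctan sin_arctan)
  show thesis
  proof
    show "\<kappa>\<^sup>2 + \<eta>\<^sup>2 = 1"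
      by (simp add: \<kappa>2)
    show \<eta>s: "\<eta> * sin w = sin s"
      using sw0 by (simp add: \<eta>_def)
    show im: "sin p * cos w + \<kappa> * cos p * sin w = 0"
      using cw by (simp add: sp r_def)
    \<comment> \<open>With zero imaginary part, the modulus determines the real part up to sign;
      both sides are negative, so they agree.\<close>
    have "(cos p * cos w - \<kappa> * sin p * sin w)\<^sup>2 = (cos p * cos w - \<kappa> * sin p * sin w)\<^sup>2 +
        (sin p * cos w + \<kappa> * cos p * sin w)\<^sup>2"
      by (simp add: im)
    also have "\<dots> = (cos w)\<^sup>2 + \<kappa>\<^sup>2 * (sin w)\<^sup>2"
      using sin_cos_squared_add[of p] by algebra
    also have "\<dots> = (cos w)\<^sup>2 + (sin w)\<^sup>2 - (\<eta> * sin w)\<^sup>2"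
      by (simp add: \<kappa>2 algebra_simps power_mult_distrib)
    also have "\<dots> = (cos s)\<^sup>2"
      by (simp add: \<eta>s cos_squared_eq)
    finally have "\<bar>cos p * cos w - \<kappa> * sin p * sin w\<bar> = \<bar>cos s\<bar>"
      using abs_eq_iff power2_eq_iff by blast
    moreover have "cos p * cos w < 0"
      using cp cw by (simp add: mult_pos_neg)
    moreover have "\<kappa> * sin p * sin w \<ge> 0"
      using \<kappa> r cp sw0 by (simp add: sp)
    ultimately show "cos p * cos w - \<kappa> * sin p * sin w = cos s"
      using C by (simp add: C_def)
    have p: "0 \<le> p" "p \<le> r"
      using r abs_arctan_le[of r] by (simp_all add: p_def)
    then have "0 \<le> p + \<kappa> * w" "p + \<kappa> * w \<le> \<kappa> * (w - sin w / cos w)"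
      using \<kappa> w by (auto simp: r_def algebra_simps)
    then have "(p + \<kappa> * w)\<^sup>2 \<le> \<kappa>\<^sup>2 * (w - sin w / cos w)\<^sup>2"
      using power_mono[of "p + \<kappa> * w" "\<kappa> * (w - sin w / cos w)" 2] by (simp add: power_mult_distrib)
    then have "\<beta> * (p + \<kappa> * w)\<^sup>2 + (\<eta> * w)\<^sup>2 \<le> \<beta> * (\<kappa>\<^sup>2 * (w - sin w / cos w)\<^sup>2) + (\<eta> * w)\<^sup>2"
      using \<beta> by simp
    also have "\<dots> = \<Phi> w"
      unfolding \<Phi>_def \<eta>_def[symmetric] \<kappa>2[symmetric] by (simp add: \<kappa>2 algebra_simps power_mult_distrib)
    finally show "\<beta> * (p + \<kappa> * w)\<^sup>2 + (\<eta> * w)\<^sup>2 < s\<^sup>2"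
      using \<Phi> by simp
  qed
qed

section \<open>The three bounds\<close>

text \<open>Columns \<open>i\<close> and \<open>j\<close> rotate in their own plane with angular
  speed \<open>a\<close>. Here \<open>H = 0\<close> and \<open>A\<close> has entries plus and minus
  \<open>a\<close>, so unit speed means \<open>2 * \<beta> * a\<^sup>2 = 1\<close>, with period
  \<open>2 * sqrt (2 * \<beta>) * pi\<close>.\<close>

lemma injectivity_radius_le_rotation:
  fixes i j :: "'p::finite" and k l :: "'q::finite"
  assumes "\<beta> > 0" "i \<noteq> j" "k \<noteq> l"
  shows "injectivity_radius (stiefel :: (real^'p^('p + 'q)) set) stiefel_tangent (stiefel_metric \<beta>)
    \<le> ereal (sqrt (2 * \<beta>) * pi)"
proof -
  define a where "a = 1 / sqrt (2 * \<beta>)"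
  have a: "a\<^sup>2 * (2 * \<beta>) = 1"
    using assms(1) by (simp add: a_def power_divide)
  interpret unit_speed_two_frame \<beta> "- a\<^sup>2" "- a\<^sup>2" "- a\<^sup>2" "- a\<^sup>2" i j
    "\<lambda>t. plane_vec i j k l (cos (a * t)) (sin (a * t)) 0 0"
    "\<lambda>t. plane_vec i j k l (- sin (a * t)) (cos (a * t)) 0 0"
    "\<lambda>t. plane_vec i j k l (- a * sin (a * t)) (a * cos (a * t)) 0 0"
    "\<lambda>t. plane_vec i j k l (- a * cos (a * t)) (- a * sin (a * t)) 0 0"
  proof (unfold_locales, goal_cases)
    \<comment> \<open>Goals 10 to 13 are the derivatives of the locale, 14 and 15 the rotation
      equations, 16 the unit speed.\<close>
    case (10 t)
    show ?case
      by (rule has_vector_derivative_plane_vec; auto intro!: derivative_eq_intros)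
  next
    case (11 t)
    show ?case
      by (rule has_vector_derivative_plane_vec; auto intro!: derivative_eq_intros)
  next
    case (12 t)
    show ?case
      unfolding scaleR_plane_vec
      by (rule has_vector_derivative_plane_vec; auto intro!: derivative_eq_intros simp: power2_eq_square)
  next
    case (13 t)
    show ?case
      unfolding scaleR_plane_vec
      by (rule has_vector_derivative_plane_vec; auto intro!: derivative_eq_intros simp: power2_eq_square)
  next
    case (14 t)
    have "- sin (a * t) * (- a * sin (a * t)) + cos (a * t) * (a * cos (a * t)) + 0 * 0 + 0 * 0 = a"
      using sin_cos_squared_add[of "a * t"] by algebra
    then show ?case
      unfolding inner_plane_vec[OF assms(2,3)] by (simp add: scaleR_plane_vec plane_vec_add power2_eq_square mult.assoc)
  next
    case (15 t)
    have "cos (a * t) * (- a * cos (a * t)) + sin (a * t) * (- a * sin (a * t)) + 0 * 0 + 0 * 0 = - a"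
      using sin_cos_squared_add[of "a * t"] by algebra
    then show ?case
      unfolding inner_plane_vec[OF assms(2,3)] by (simp add: scaleR_plane_vec plane_vec_add power2_eq_square mult.assoc)
  next
    case (16 t)
    show ?case
      unfolding inner_plane_vec[OF assms(2,3)]
      \<comment> \<open>The middle term is reached by polynomial arithmetic alone; only then are the
        sums of squares replaced by 1.\<close>
      by (rule trans[of _ "2 * a\<^sup>2 * ((sin (a * t))\<^sup>2 + (cos (a * t))\<^sup>2) +
          (\<beta> - 1) * (2 * a\<^sup>2 * ((sin (a * t))\<^sup>2 + (cos (a * t))\<^sup>2)\<^sup>2)"])
        (simp add: power2_eq_square algebra_simps del: sin_cos_squared_add sin_cos_squared_add3,
          use a in \<open>simp add: algebra_simps\<close>)
  qed (use assms sin_cos_squared_add[of "a * t" for t] in \<open>simp_all add: avoids_plane_vec inner_plane_vec scaleR_plane_vec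
      plane_vec_add power2_eq_square algebra_simps\<close>)
  show ?thesis
  proof (rule injectivity_radius_leI)
    fix t assume t: "t > sqrt (2 * \<beta>) * pi"
    have "a * (t - 2 * (sqrt (2 * \<beta>) * pi)) = a * t - 2 * pi" for t
      using assms(1) by (simp add: a_def field_simps)
    then show "riemannian_dist stiefel (stiefel_metric \<beta>) (curve 0) (curve t) < t"
      using t assms(1) by (intro dist_periodic_less[of "sqrt (2 * \<beta>) * pi"]) (simp_all add: sin_diff cos_diff)
  qed
qed

text \<open>Column \<open>i\<close> runs through a great circle towards the axis
  \<open>Inr k\<close> while column \<open>j\<close> stays fixed. The skew block is zero, so \<beta>
  does not affect the speed.\<close>

lemma injectivity_radius_le_single_column:
  fixes i j :: "'p::finite" and k l :: "'q::finite"
  assumes "\<beta> > 0" "i \<noteq> j" "k \<noteq> l"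
  shows "injectivity_radius (stiefel :: (real^'p^('p + 'q)) set) stiefel_tangent (stiefel_metric \<beta>)
    \<le> ereal (pi)"
proof -
  interpret unit_speed_two_frame \<beta> "- 1" 0 0 0 i j
    "\<lambda>t. plane_vec i j k l (cos t) 0 (sin t) 0"
    "\<lambda>t. plane_vec i j k l 0 1 0 0"
    "\<lambda>t. plane_vec i j k l (- sin t) 0 (cos t) 0"
    "\<lambda>t. plane_vec i j k l 0 0 0 0"
  proof (unfold_locales, goal_cases)
    case (10 t)
    show ?case
      by (rule has_vector_derivative_plane_vec; auto intro!: derivative_eq_intros)
  next
    case (11 t)
    show ?case
      by (rule has_vector_derivative_plane_vec; auto intro!: derivative_eq_intros)
  next
    case (12 t)
    show ?case
      unfolding scaleR_plane_vec
      by (rule has_vector_derivative_plane_vec; auto intro!: derivative_eq_intros simp: power2_eq_square)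
  next
    case (13 t)
    show ?case
      unfolding scaleR_plane_vec
      by (rule has_vector_derivative_plane_vec; auto intro!: derivative_eq_intros simp: power2_eq_square)
  next
    case (16 t)
    show ?case
      unfolding inner_plane_vec[OF assms(2,3)] by (rule trans[of _ "(sin t)\<^sup>2 + (cos t)\<^sup>2"])
        (simp add: power2_eq_square algebra_simps del: sin_cos_squared_add sin_cos_squared_add3,
          use assms in \<open>simp add: algebra_simps\<close>)
  qed (use assms sin_cos_squared_add[of "t" for t] in \<open>simp_all add: avoids_plane_vec inner_plane_vec scaleR_plane_vec
      plane_vec_add power2_eq_square algebra_simps\<close>)
  show ?thesis
  proof (rule injectivity_radius_leI)
    fix t :: real assume t: "t > pi"
    then show "riemannian_dist stiefel (stiefel_metric \<beta>) (curve 0) (curve t) < t"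
      using t assms(1) by (intro dist_periodic_less[of "pi"]) (simp_all add: sin_diff cos_diff)
  qed
qed

text \<open>Both columns turn by the same angle \<open>h * t\<close> into separate fresh axes. The
  skew block is zero, so this is a horizontal geodesic of the Berger sphere, with unit speed for
  \<open>2 * h\<^sup>2 = 1\<close>.\<close>

lemma injectivity_radius_le_t_r:
  fixes i j :: "'p::finite" and k l :: "'q::finite"
  assumes "\<beta> > 0" "i \<noteq> j" "k \<noteq> l" "\<beta> < 1"
  shows "injectivity_radius (stiefel :: (real^'p^('p + 'q)) set) stiefel_tangent (stiefel_metric \<beta>)
    \<le> ereal (t_r \<beta> * sqrt 2)"
proof -
  define h where "h = 1 / sqrt 2"
  have h: "h\<^sup>2 * 2 = 1"
    by (simp add: h_def power_divide)
  interpret unit_speed_two_frame \<beta> "- h\<^sup>2" "- h\<^sup>2" 0 0 i j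
    "\<lambda>t. plane_vec i j k l (cos (h * t)) 0 (sin (h * t)) 0"
    "\<lambda>t. plane_vec i j k l 0 (cos (h * t)) 0 (sin (h * t))"
    "\<lambda>t. plane_vec i j k l (- h * sin (h * t)) 0 (h * cos (h * t)) 0"
    "\<lambda>t. plane_vec i j k l 0 (- h * sin (h * t)) 0 (h * cos (h * t))"
  proof (unfold_locales, goal_cases)
    case (10 t)
    show ?case
      by (rule has_vector_derivative_plane_vec; auto intro!: derivative_eq_intros)
  next
    case (11 t)
    show ?case
      by (rule has_vector_derivative_plane_vec; auto intro!: derivative_eq_intros)
  next
    case (12 t)
    show ?case
      unfolding scaleR_plane_vec
      by (rule has_vector_derivative_plane_vec; auto intro!: derivative_eq_intros simp: power2_eq_square)
  next
    case (13 t)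
    show ?case
      unfolding scaleR_plane_vec
      by (rule has_vector_derivative_plane_vec; auto intro!: derivative_eq_intros simp: power2_eq_square)
  next
    case (16 t)
    show ?case
      unfolding inner_plane_vec[OF assms(2,3)] by (rule trans[of _ "2 * h\<^sup>2 * ((sin (h * t))\<^sup>2 + (cos (h * t))\<^sup>2)"])
        (simp add: power2_eq_square algebra_simps del: sin_cos_squared_add sin_cos_squared_add3,
          use h in \<open>simp add: algebra_simps\<close>)
  qed (use assms sin_cos_squared_add[of "h * t" for t] in \<open>simp_all add: avoids_plane_vec inner_plane_vec scaleR_plane_vec
      plane_vec_add power2_eq_square algebra_simps\<close>)
  have curve: "curve t = sphere_frame i j k l (cos (h * t)) 0 (sin (h * t)) 0" for t
    by (simp add: curve_def sphere_frame_def)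
  show ?thesis
  proof (rule injectivity_radius_leI)
    fix t :: real assume t: "t > t_r \<beta> * sqrt 2" "t > 0"
    define s where "s = h * t"
    have ts: "t = sqrt 2 * s" "t_r \<beta> < s" "s > 0"
      using t by (auto simp: s_def h_def field_simps)
    show "riemannian_dist stiefel (stiefel_metric \<beta>) (curve 0) (curve t) < t"
    proof (cases "s \<le> pi")
      case True
      obtain \<kappa> \<eta> p \<omega> where helix: "\<kappa>\<^sup>2 + \<eta>\<^sup>2 = 1" "cos p * cos \<omega> - \<kappa> * sin p * sin \<omega> = cos s"
          "sin p * cos \<omega> + \<kappa> * cos p * sin \<omega> = 0" "\<eta> * sin \<omega> = sin s"
          "\<beta> * (p + \<kappa> * \<omega>)\<^sup>2 + (\<eta> * \<omega>)\<^sup>2 < s\<^sup>2"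
      proof (cases "s = pi")
        case True
        show thesis
          by (rule that[of 1 0 0 pi]) (use True assms in auto)
      next
        case False
        then show thesis
          using shorter_helix[of \<beta> s thesis] that assms True t_r_gt_half_pi[OF assms(1,4)]
            t_r_less_imp_neg[OF assms(1,4)] ts by auto
      qed
      have "riemannian_dist stiefel (stiefel_metric \<beta>) (curve 0) (curve t)
          \<le> sqrt (2 * (\<beta> * (p + \<kappa> * \<omega>)\<^sup>2 + (\<eta> * \<omega>)\<^sup>2))"
        unfolding curve s_def[symmetric]
        using riemannian_dist_helix_le[OF assms(1-3) helix(1-4)] by simp
      also have "\<dots> < sqrt (2 * s\<^sup>2)"
        using helix(5) by simp
      also have "\<dots> = t"
        using ts by (simp add: real_sqrt_mult)
      finally show ?thesis .
    next
      case False
      \<comment> \<open>Beyond \<open>s = pi\<close> the geodesic has passed half of its period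
        \<open>2 * sqrt 2 * pi\<close>, so going round the other way is shorter.\<close>
      then have "t > sqrt 2 * pi"
        by (simp add: ts)
      moreover have "h * (t - 2 * (sqrt 2 * pi)) = h * t - 2 * pi" for t
        by (simp add: h_def field_simps)
      ultimately show ?thesis
        by (intro dist_periodic_less[of "sqrt 2 * pi"]) (simp_all add: sin_diff cos_diff)
    qed
  qed
qed

theorem theorem7p1:
  fixes n p :: nat and \<beta> :: real
  assumes "CARD('p::finite) = p" and "CARD('p + 'q::finite) = n"
    and "2 \<le> p" and "p + 2 \<le> n" and "\<beta> > 0"
  shows "injectivity_radius (stiefel :: (real^'p^('p + 'q)) set) stiefel_tangent (stiefel_metric \<beta>)
         \<le> ereal (Min {sqrt (2 * \<beta>) * pi, pi, t_r \<beta> * sqrt 2})"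
proof -
  have "CARD('p) \<ge> 2" "CARD('q) \<ge> 2"
    using assms by auto
  then obtain i j :: 'p and k l :: 'q where neq: "i \<noteq> j" "k \<noteq> l"
    by (metis (full_types) card_le_Suc0_iff_eq finite_class.finite_UNIV not_less_eq_eq numeral_2_eq_2)
  note rotation = injectivity_radius_le_rotation[OF assms(5) neq]
    and single_column = injectivity_radius_le_single_column[OF assms(5) neq]
  have "injectivity_radius (stiefel :: (real^'p^('p + 'q)) set) stiefel_tangent (stiefel_metric \<beta>)
      \<le> ereal (t_r \<beta> * sqrt 2)"
  proof (cases "\<beta> < 1")
    case True
    then show ?thesis
      using injectivity_radius_le_t_r[OF assms(5) neq] by blast
  next
    \<comment> \<open>Here \<open>t_r \<beta> * sqrt 2\<close> is at least \<open>pi\<close>, and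
      the bound by \<open>pi\<close> already implies the claim.\<close>
    case False
    then have "pi \<le> t_r \<beta>"
      by (intro t_r_ge_pi) simp
    moreover have "1 \<le> sqrt 2"
      by simp
    ultimately have "pi * 1 \<le> t_r \<beta> * sqrt 2"
      using pi_gt_zero by (intro mult_mono) linarith+
    then show ?thesis
      using single_column by (auto intro: order_trans)
  qed
  then show ?thesis
    using rotation single_column by (auto simp: min_def)
qed

end
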